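(* Let $\mathfrak g=\mathfrak{sl}(n+1,\mathbb C)$ with $n\ge1$, and let $k\ge0$, $1\le p\le n$ be integers. Let $\mu=\sum_{i=1}^{n+1}a_i\varepsilon_i$ be a weight written with all $a_i\in\mathbb Z_{\ge0}$ and $\sum_{i=1}^{n+1}a_i=k+p$. If $a_1+\dots+a_j\le k+j$ for all $1\le j\le p$, then $$m_{\pi_{k\omega_1+\omega_p}}(\mu)=\binom{n-Z(\mu)}{p-1}.$$ Otherwise $m_{\pi_{k\omega_1+\omega_p}}(\mu)=0$.
   Context: Take $\mathfrak h=\{\mathrm{diag}(\theta_1,\dots,\theta_{n+1}):\sum\theta_i=0\}$, with $\varepsilon_i(\mathrm{diag}(\theta))=\theta_i$, so that $\mathfrak h^*=\bigoplus\mathbb C\varepsilon_i/\langle\sum_i\varepsilon_i\rangle$. The positive roots are $\varepsilon_i-\varepsilon_j$ ($i<j$), and the fundamental weights are $\omega_p=\varepsilon_1+\dots+\varepsilon_p$. $\pi_\lambda$ is the irreducible representation with highest weight $\lambda$, and $m_\pi(\mu)$ is the weight multiplicity. Here $Z(\mu)=\#\{1\le i\le n+1: a_i=0\}$ for the representative with $\sum_i a_i=k+p$. Convention: $\binom{b}{a}=0$ if $a<0$ or $b<a$. *)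

theory Defs
  imports Complex_Main
begin

text \<open>Matrices of size (n+1) x (n+1) are modelled as functions nat => nat => complex,
  with indices 0..n (index i corresponds to epsilon_(i+1) in the paper) and entries
  zero outside that range.\<close>

type_synonym cmat = "nat \<Rightarrow> nat \<Rightarrow> complex"

definition sl :: "nat \<Rightarrow> cmat set" where
  "sl n = {M. (\<forall>i j. (n < i \<or> n < j) \<longrightarrow> M i j = 0) \<and> (\<Sum>i\<le>n. M i i) = 0}"

definition cartan :: "nat \<Rightarrow> cmat set" where
  "cartan n = {M \<in> sl n. \<forall>i j. i \<noteq> j \<longrightarrow> M i j = 0}"

definition mat_mul :: "nat \<Rightarrow> cmat \<Rightarrow> cmat \<Rightarrow> cmat" where
  "mat_mul n A B = (\<lambda>i j. \<Sum>l\<le>n. A i l * B l j)"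

definition lie_bracket :: "nat \<Rightarrow> cmat \<Rightarrow> cmat \<Rightarrow> cmat" where
  "lie_bracket n A B = (\<lambda>i j. mat_mul n A B i j - mat_mul n B A i j)"

definition elem_mat :: "nat \<Rightarrow> nat \<Rightarrow> cmat" where
  "elem_mat a b = (\<lambda>i j. if i = a \<and> j = b then 1 else 0)"

definition is_fd_rep :: "nat \<Rightarrow> (complex \<Rightarrow> 'v::ab_group_add \<Rightarrow> 'v) \<Rightarrow> (cmat \<Rightarrow> 'v \<Rightarrow> 'v) \<Rightarrow> bool" where
  "is_fd_rep n scale \<rho> \<longleftrightarrow>
     vector_space scale \<and>
     (\<exists>B. finite B \<and> module.span scale B = UNIV) \<and>
     (\<forall>X\<in>sl n. Vector_Spaces.linear scale scale (\<rho> X)) \<and>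
     (\<forall>X\<in>sl n. \<forall>Y\<in>sl n. \<forall>v. \<rho> (\<lambda>i j. X i j + Y i j) v = \<rho> X v + \<rho> Y v) \<and>
     (\<forall>X\<in>sl n. \<forall>c v. \<rho> (\<lambda>i j. c * X i j) v = scale c (\<rho> X v)) \<and>
     (\<forall>X\<in>sl n. \<forall>Y\<in>sl n. \<forall>v. \<rho> (lie_bracket n X Y) v = \<rho> X (\<rho> Y v) - \<rho> Y (\<rho> X v))"

definition is_irreducible :: "nat \<Rightarrow> (complex \<Rightarrow> 'v::ab_group_add \<Rightarrow> 'v) \<Rightarrow> (cmat \<Rightarrow> 'v \<Rightarrow> 'v) \<Rightarrow> bool" where
  "is_irreducible n scale \<rho> \<longleftrightarrow>
     (UNIV :: 'v set) \<noteq> {0} \<and>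
     (\<forall>W. module.subspace scale W \<and> (\<forall>X\<in>sl n. \<forall>w\<in>W. \<rho> X w \<in> W) \<longrightarrow> W = {0} \<or> W = UNIV)"

definition weight_space :: "nat \<Rightarrow> (complex \<Rightarrow> 'v::ab_group_add \<Rightarrow> 'v) \<Rightarrow> (cmat \<Rightarrow> 'v \<Rightarrow> 'v) \<Rightarrow> (nat \<Rightarrow> int) \<Rightarrow> 'v set" where
  "weight_space n scale \<rho> a = {v. \<forall>H\<in>cartan n. \<rho> H v = scale (\<Sum>i\<le>n. of_int (a i) * H i i) v}"

definition has_highest_weight :: "nat \<Rightarrow> (complex \<Rightarrow> 'v::ab_group_add \<Rightarrow> 'v) \<Rightarrow> (cmat \<Rightarrow> 'v \<Rightarrow> 'v) \<Rightarrow> (nat \<Rightarrow> int) \<Rightarrow> bool" where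
  "has_highest_weight n scale \<rho> lam \<longleftrightarrow>
     (\<exists>v. v \<noteq> 0 \<and> v \<in> weight_space n scale \<rho> lam \<and>
          (\<forall>i j. i < j \<and> j \<le> n \<longrightarrow> \<rho> (elem_mat i j) v = 0))"

definition weight_mult :: "nat \<Rightarrow> (complex \<Rightarrow> 'v::ab_group_add \<Rightarrow> 'v) \<Rightarrow> (cmat \<Rightarrow> 'v \<Rightarrow> 'v) \<Rightarrow> (nat \<Rightarrow> int) \<Rightarrow> nat" where
  "weight_mult n scale \<rho> a = vector_space.dim scale (weight_space n scale \<rho> a)"

text \<open>Coefficients of k*omega_1 + omega_p = (k+1) eps_1 + eps_2 + ... + eps_p.\<close>
definition hw_coeffs :: "nat \<Rightarrow> nat \<Rightarrow> nat \<Rightarrow> int" where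
  "hw_coeffs k p i = (if i = 0 then int k else 0) + (if i < p then 1 else 0)"

definition Zcount :: "nat \<Rightarrow> (nat \<Rightarrow> nat) \<Rightarrow> nat" where
  "Zcount n a = card {i. i \<le> n \<and> a i = 0}"

end

theory Submission
  imports Defs "HOL-Library.Function_Algebras" "HOL-Library.Product_Plus"
begin

text \<open>
  Every weight \<open>a\<close> has multiplicity \<open>(r - 1) choose (p - 1)\<close>, where \<open>r\<close> is the number of nonzero
  \<open>a\<^sub>i\<close>; if a partial sum is too large, then \<open>r < p\<close> and the binomial coefficient vanishes.

  The representation is realised inside \<open>Sym \<otimes> \<Lambda>\<close>, on which the matrix units act by
  \<open>x\<^sub>i \<partial>\<^sub>j + c\<^sub>i\<^sup>* c\<^sub>j\<close>, as the image of the Koszul differential \<open>d = \<Sum> x\<^sub>i c\<^sub>i\<close> from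
  \<open>Sym\<^sup>k \<otimes> \<Lambda>\<^sup>p\<close> to \<open>Sym\<^sup>k\<^sup>+\<^sup>1 \<otimes> \<Lambda>\<^sup>p\<^sup>-\<^sup>1\<close>. It is generated by \<open>d (x\<^sub>1\<^sup>k \<otimes> e\<^sub>1 \<and> \<dots> \<and> e\<^sub>p)\<close>, and an inner
  product for which the matrix units \<open>(i, j)\<close> and \<open>(j, i)\<close> are adjoint makes it isomorphic to any
  irreducible representation with the same highest weight. For \<open>m\<close> with \<open>a\<^sub>m \<noteq> 0\<close>, its weight space
  has the basis \<open>d (x\<^bsup>a - S\<^esup> \<otimes> e\<^sub>S)\<close>, where \<open>S\<close> runs over the \<open>p\<close>-element subsets of the support of
  \<open>a\<close> that contain \<open>m\<close>.
\<close>

section \<open>Highest weight vectors\<close>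

text \<open>Duality makes the \<open>u j\<close> distinct and independent. They span
  \<open>U\<close> because \<open>x\<close> and the combination of the \<open>u j\<close> with
  coefficients \<open>\<xi> j x\<close> agree under every \<open>\<xi> j\<close>, and these
  functionals separate the points of \<open>U\<close>.\<close>

lemma (in vector_space) dim_eq_card_dual:
  assumes J: "finite J" and u: "\<And>j. j \<in> J \<Longrightarrow> u j \<in> U" and U: "subspace U"
    and add: "\<And>j x y. \<xi> j (x + y) = \<xi> j x + \<xi> j y"
    and scale: "\<And>j c x. \<xi> j (scale c x) = c * \<xi> j x"
    and dual: "\<And>i j. i \<in> J \<Longrightarrow> j \<in> J \<Longrightarrow> \<xi> i (u j) = (if i = j then 1 else 0)"
    and sep: "\<And>x. x \<in> U \<Longrightarrow> (\<And>j. j \<in> J \<Longrightarrow> \<xi> j x = 0) \<Longrightarrow> x = 0"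
  shows "dim U = card J"
proof -
  have zero: "\<xi> j 0 = 0" for j
    using scale[of j 0 0] by simp
  have sum: "\<xi> i (\<Sum>x\<in>A. g x) = (\<Sum>x\<in>A. \<xi> i (g x))" for i A and g :: "'d \<Rightarrow> 'b"
    by (induction A rule: infinite_finite_induct) (auto simp: zero add)
  have coeff: "\<xi> i (\<Sum>j\<in>J. scale (c j) (u j)) = c i" if "i \<in> J" for i c
  proof -
    have "\<xi> i (\<Sum>j\<in>J. scale (c j) (u j)) = (\<Sum>j\<in>J. if i = j then c j else 0)"
      unfolding sum by (intro sum.cong refl) (use that in \<open>auto simp: scale dual\<close>)
    then show ?thesis
      using that J by simp
  qed
  have inj: "inj_on u J"
  proof (rule inj_onI)
    fix i j assume ij: "i \<in> J" "j \<in> J" "u i = u j"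
    then have "\<xi> i (u i) = \<xi> i (u j)" by simp
    then show "i = j" using ij(1,2) by (simp add: dual split: if_splits)
  qed
  have "independent (u ` J)"
  proof
    assume "dependent (u ` J)"
    then obtain c j where c: "(\<Sum>x\<in>u ` J. scale (c x) x) = 0" and j: "j \<in> J" "c (u j) \<noteq> 0"
      using J by (auto simp: dependent_finite)
    have "(\<Sum>j\<in>J. scale (c (u j)) (u j)) = 0"
      using c inj by (simp add: sum.reindex)
    then show False
      using coeff[OF j(1), of "\<lambda>j. c (u j)"] j zero by simp
  qed
  moreover have "U \<subseteq> span (u ` J)"
  proof
    fix x assume x: "x \<in> U"
    define y where "y = (\<Sum>j\<in>J. scale (\<xi> j x) (u j))"
    have yU: "y \<in> U"
      unfolding y_def using U u by (intro subspace_sum subspace_scale)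
    have "\<xi> j (x - y) = 0" if "j \<in> J" for j
    proof -
      have "\<xi> j x = \<xi> j (x - y) + \<xi> j y"
        using add[of j "x - y" y] by simp
      then show ?thesis
        using coeff[OF that, of "\<lambda>j. \<xi> j x"] by (simp add: y_def)
    qed
    then have "x - y = 0"
      using x yU U by (intro sep) (auto intro: subspace_diff)
    moreover have "y \<in> span (u ` J)"
      unfolding y_def by (intro span_sum span_scale span_base imageI)
    ultimately show "x \<in> span (u ` J)"
      by simp
  qed
  ultimately show ?thesis
    using u inj by (intro dim_unique[of "u ` J"]) (auto simp: card_image)
qed

section \<open>sl(n+1) as the span of its diagonal part and the off-diagonal matrix units\<close>

lemma elem_mat_in_sl: "i \<noteq> j \<Longrightarrow> i \<le> n \<Longrightarrow> j \<le> n \<Longrightarrow> elem_mat i j \<in> sl n"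
  by (auto simp: sl_def elem_mat_def intro!: sum.neutral)

lemma lie_bracket_in_sl:
  assumes "X \<in> sl n" "Y \<in> sl n"
  shows "lie_bracket n X Y \<in> sl n"
proof -
  have "(\<Sum>i\<le>n. mat_mul n X Y i i) = (\<Sum>i\<le>n. mat_mul n Y X i i)"
    unfolding mat_mul_def by (subst sum.swap) (simp add: mult.commute)
  then show ?thesis
    using assms by (auto simp: sl_def lie_bracket_def mat_mul_def sum_subtractf)
qed

text \<open>Start from the diagonal part, which has trace 0 and so lies in the Cartan subalgebra,
  and restore the off-diagonal entries one position at a time.\<close>

lemma sl_mem_induct:
  assumes X: "X \<in> sl n"
    and add: "\<And>Y Z. Y \<in> sl n \<Longrightarrow> Z \<in> sl n \<Longrightarrow> P Y \<Longrightarrow> P Z \<Longrightarrow> P (\<lambda>i j. Y i j + Z i j)"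
    and scale: "\<And>c Y. Y \<in> sl n \<Longrightarrow> P Y \<Longrightarrow> P (\<lambda>i j. c * Y i j)"
    and cartan: "\<And>H. H \<in> cartan n \<Longrightarrow> P H"
    and elem: "\<And>i j. i \<noteq> j \<Longrightarrow> i \<le> n \<Longrightarrow> j \<le> n \<Longrightarrow> P (elem_mat i j)"
  shows "P X"
proof -
  let ?D = "\<lambda>A i j. if i = j \<or> (i, j) \<in> A then X i j else 0"
  have inD: "?D A \<in> sl n" for A
    using X by (auto simp: sl_def)
  have "P (?D A)" if "finite A" "A \<subseteq> {(i, j). i \<noteq> j \<and> i \<le> n \<and> j \<le> n}" for A
    using that
  proof (induction rule: finite_induct)
    case empty
    have "?D {} \<in> cartan n"
      using inD[of "{}"] by (auto simp: cartan_def)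
    then show ?case
      by (rule cartan)
  next
    case (insert q A)
    obtain r s where q: "q = (r, s)" "r \<noteq> s" "r \<le> n" "s \<le> n"
      using insert.prems by auto
    have sc: "(\<lambda>i j. X r s * elem_mat r s i j) \<in> sl n"
      using elem_mat_in_sl[OF q(2-4)] by (auto simp: sl_def simp flip: sum_distrib_left)
    have "P (\<lambda>i j. ?D A i j + X r s * elem_mat r s i j)"
      using q insert.prems
      by (intro add inD sc scale elem insert.IH elem_mat_in_sl) auto
    also have "(\<lambda>i j. ?D A i j + X r s * elem_mat r s i j) = ?D (insert q A)"
      using q insert.hyps by (auto simp: fun_eq_iff elem_mat_def)
    finally show ?case .
  qed
  from this[of "{(i, j). i \<noteq> j \<and> i \<le> n \<and> j \<le> n}"]
  have "P (?D {(i, j). i \<noteq> j \<and> i \<le> n \<and> j \<le> n})"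
    by (auto intro: finite_subset[of _ "{..n} \<times> {..n}"])
  also have "?D {(i, j). i \<noteq> j \<and> i \<le> n \<and> j \<le> n} = X"
    using X by (force simp: fun_eq_iff sl_def not_le)
  finally show ?thesis .
qed

section \<open>Representations and the submodule generated by a highest weight vector\<close>

text \<open>The dimension is unrestricted, so that the Fock space and its direct sum with an
  abstract module are instances.\<close>

locale sl_rep = vector_space scale
  for scale :: "complex \<Rightarrow> 'v::ab_group_add \<Rightarrow> 'v" +
  fixes n :: nat and \<rho> :: "cmat \<Rightarrow> 'v \<Rightarrow> 'v"
  assumes rho_add: "X \<in> sl n \<Longrightarrow> \<rho> X (u + v) = \<rho> X u + \<rho> X v"
    and rho_scale: "X \<in> sl n \<Longrightarrow> \<rho> X (scale c v) = scale c (\<rho> X v)"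
    and rho_plus: "X \<in> sl n \<Longrightarrow> Y \<in> sl n \<Longrightarrow> \<rho> (\<lambda>i j. X i j + Y i j) v = \<rho> X v + \<rho> Y v"
    and rho_times: "X \<in> sl n \<Longrightarrow> \<rho> (\<lambda>i j. c * X i j) v = scale c (\<rho> X v)"
    and rho_bracket: "X \<in> sl n \<Longrightarrow> Y \<in> sl n \<Longrightarrow>
      \<rho> (lie_bracket n X Y) v = \<rho> X (\<rho> Y v) - \<rho> Y (\<rho> X v)"
begin

lemma rho_zero: "X \<in> sl n \<Longrightarrow> \<rho> X 0 = 0"
  using rho_add[of X 0 0] by simp

text \<open>The index adds up the heights \<open>i - j\<close> of the lowering operators applied; it
  reappears as the drop of an eigenvalue.\<close>

inductive lowering_word :: "'v \<Rightarrow> nat \<Rightarrow> 'v \<Rightarrow> bool" for v where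
  base: "lowering_word v 0 v"
| step: "lowering_word v l x \<Longrightarrow> j < i \<Longrightarrow> i \<le> n \<Longrightarrow>
    lowering_word v (l + (i - j)) (\<rho> (elem_mat i j) x)"

definition cyclic :: "'v \<Rightarrow> 'v set" where
  "cyclic v = span {x. \<exists>l. lowering_word v l x}"

lemma cyclic_self: "v \<in> cyclic v"
  unfolding cyclic_def by (rule span_base) (auto intro: lowering_word.base)

lemma rho_mem_span:
  assumes "X \<in> sl n" "\<And>x. x \<in> B \<Longrightarrow> \<rho> X x \<in> span C" "x \<in> span B"
  shows "\<rho> X x \<in> span C"
  using assms(3)
  by (induction rule: span_induct_alt)
    (auto simp: rho_zero rho_add rho_scale assms(1) intro!: span_zero span_add span_scale assms(2))

lemma cyclic_lower:
  assumes "x \<in> cyclic v" "j < i" "i \<le> n"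
  shows "\<rho> (elem_mat i j) x \<in> cyclic v"
  using assms(1) unfolding cyclic_def
  by (rule rho_mem_span[rotated 2])
    (use assms(2,3) in \<open>auto intro!: elem_mat_in_sl span_base intro: lowering_word.step\<close>)

lemma weight_space_cartan:
  assumes "v \<in> weight_space n scale \<rho> a" "H \<in> cartan n"
  shows "\<rho> H v = scale (\<Sum>i\<le>n. of_int (a i) * H i i) v"
  using assms by (auto simp: weight_space_def)

text \<open>The induction on words must treat all \<open>X\<close> at once: in X(e y) = e(X y) +
  [X, e] y the hypothesis for \<open>y\<close> is needed both for \<open>X\<close> and for the
  commutator.\<close>

lemma cyclic_invariant:
  assumes v: "v \<in> weight_space n scale \<rho> lam"
    and up: "\<And>i j. i < j \<Longrightarrow> j \<le> n \<Longrightarrow> \<rho> (elem_mat i j) v = 0"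
    and x: "x \<in> cyclic v" and X: "X \<in> sl n"
  shows "\<rho> X x \<in> cyclic v"
proof -
  have sub: "subspace (cyclic v)"
    by (simp add: cyclic_def)
  have word: "\<rho> X y \<in> cyclic v" if "lowering_word v l y" "X \<in> sl n" for X y l
    using that
  proof (induction arbitrary: X rule: lowering_word.induct)
    case base
    show ?case
    proof (rule sl_mem_induct[OF base])
      fix Y Z assume "Y \<in> sl n" "Z \<in> sl n" "\<rho> Y v \<in> cyclic v" "\<rho> Z v \<in> cyclic v"
      then show "\<rho> (\<lambda>i j. Y i j + Z i j) v \<in> cyclic v"
        using sub by (simp add: rho_plus subspace_add)
    next
      fix c Y assume "Y \<in> sl n" "\<rho> Y v \<in> cyclic v"
      then show "\<rho> (\<lambda>i j. c * Y i j) v \<in> cyclic v"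
        using sub by (simp add: rho_times subspace_scale)
    next
      fix H assume "H \<in> cartan n"
      then show "\<rho> H v \<in> cyclic v"
        using sub weight_space_cartan[OF v] cyclic_self by (simp add: subspace_scale)
    next
      fix i j :: nat assume ij: "i \<noteq> j" "i \<le> n" "j \<le> n"
      show "\<rho> (elem_mat i j) v \<in> cyclic v"
      proof (cases "i < j")
        case True
        then show ?thesis using up ij sub by (simp add: subspace_0)
      next
        case False
        then show ?thesis using ij by (intro cyclic_lower cyclic_self) auto
      qed
    qed
  next
    case (step l y j i)
    have e: "elem_mat i j \<in> sl n"
      using step.hyps by (intro elem_mat_in_sl) auto
    have "\<rho> X (\<rho> (elem_mat i j) y) =
        \<rho> (elem_mat i j) (\<rho> X y) + \<rho> (lie_bracket n X (elem_mat i j)) y"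
      using rho_bracket[OF step.prems e] by (simp add: algebra_simps)
    moreover have "\<rho> (elem_mat i j) (\<rho> X y) \<in> cyclic v"
      using step by (intro cyclic_lower) auto
    moreover have "\<rho> (lie_bracket n X (elem_mat i j)) y \<in> cyclic v"
      using step e by (intro step.IH lie_bracket_in_sl) auto
    ultimately show ?case
      using sub by (simp add: subspace_add)
  qed
  show ?thesis
    using x unfolding cyclic_def
    by (rule rho_mem_span[OF X, rotated]) (use word X in \<open>auto simp: cyclic_def\<close>)
qed

end

section \<open>The height operator and the projection to its top eigenspace\<close>

text \<open>Its eigenvalue on a lowering word of height \<open>l\<close> is \<open>l\<close> less than on the starting vector.\<close>

definition height_mat :: "nat \<Rightarrow> cmat" where
  "height_mat n = (\<lambda>i j. if i = j \<and> i \<le> n then of_nat n / 2 - of_nat i else 0)"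

lemma height_mat_in_cartan: "height_mat n \<in> cartan n"
proof -
  have "(\<Sum>i\<le>n. of_nat n / 2 - of_nat i :: complex) = 0"
    using double_gauss_sum[of n, where ?'a = complex]
    by (simp add: sum_subtractf atMost_atLeast0 algebra_simps flip: add_divide_distrib)
  then show ?thesis
    by (auto simp: cartan_def sl_def height_mat_def)
qed

lemma height_mat_in_sl: "height_mat n \<in> sl n"
  using height_mat_in_cartan by (simp add: cartan_def)

lemma lie_bracket_height_mat:
  assumes "i \<le> n" "j \<le> n"
  shows "lie_bracket n (height_mat n) (elem_mat i j) =
    (\<lambda>r s. (of_nat j - of_nat i) * elem_mat i j r s)"
proof (intro ext)
  fix r s
  have "mat_mul n (height_mat n) (elem_mat i j) r s =
      (\<Sum>l\<le>n. if l = i then height_mat n r i * elem_mat i j i s else 0)"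
    unfolding mat_mul_def by (rule sum.cong) (auto simp: elem_mat_def)
  moreover have "mat_mul n (elem_mat i j) (height_mat n) r s =
      (\<Sum>l\<le>n. if l = j then elem_mat i j r j * height_mat n j s else 0)"
    unfolding mat_mul_def by (rule sum.cong) (auto simp: elem_mat_def)
  ultimately show "lie_bracket n (height_mat n) (elem_mat i j) r s =
      (of_nat j - of_nat i) * elem_mat i j r s"
    using assms by (auto simp: lie_bracket_def elem_mat_def height_mat_def)
qed

context sl_rep
begin

lemma lowering_word_height:
  assumes "lowering_word v l x" "\<rho> (height_mat n) v = scale c v"
  shows "\<rho> (height_mat n) x = scale (c - of_nat l) x"
  using assms
proof (induction rule: lowering_word.induct)
  case base
  then show ?case by simp
next
  case (step l x j i)
  have e: "elem_mat i j \<in> sl n"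
    using step.hyps by (intro elem_mat_in_sl) auto
  have "\<rho> (height_mat n) (\<rho> (elem_mat i j) x) = \<rho> (elem_mat i j) (\<rho> (height_mat n) x) +
      \<rho> (lie_bracket n (height_mat n) (elem_mat i j)) x"
    using rho_bracket[OF height_mat_in_sl e, of x] by (simp add: algebra_simps)
  also have "\<rho> (elem_mat i j) (\<rho> (height_mat n) x) = scale (c - of_nat l) (\<rho> (elem_mat i j) x)"
    using step e by (simp add: rho_scale)
  also have "\<rho> (lie_bracket n (height_mat n) (elem_mat i j)) x =
      scale (of_nat j - of_nat i) (\<rho> (elem_mat i j) x)"
    using step.hyps rho_times[OF e] by (simp add: lie_bracket_height_mat)
  finally show ?case
    using step.hyps by (simp add: of_nat_diff algebra_simps flip: scale_left_distrib)
qed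

text \<open>The product of \<open>H - (c - j)\<close> over \<open>j = 1, \<dots>, m\<close>, where \<open>H\<close> is the height operator. It
  annihilates every lowering word of height \<open>1, \<dots>, m\<close> below a vector with eigenvalue \<open>c\<close>.\<close>

fun top_proj :: "complex \<Rightarrow> nat \<Rightarrow> 'v \<Rightarrow> 'v" where
  "top_proj c 0 x = x"
| "top_proj c (Suc m) x =
    \<rho> (height_mat n) (top_proj c m x) - scale (c - of_nat (Suc m)) (top_proj c m x)"

lemma top_proj_add: "top_proj c m (x + y) = top_proj c m x + top_proj c m y"
  by (induction m) (simp_all add: rho_add[OF height_mat_in_sl] scale_right_distrib)

lemma top_proj_scale: "top_proj c m (scale d x) = scale d (top_proj c m x)"
  by (induction m)
    (simp_all add: rho_scale[OF height_mat_in_sl] scale_right_diff_distrib mult.commute)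

lemma top_proj_zero: "top_proj c m 0 = 0"
  by (induction m) (simp_all add: rho_zero[OF height_mat_in_sl])

lemma top_proj_eigen:
  assumes "\<rho> (height_mat n) x = scale (c - of_nat l) x"
  shows "top_proj c m x = scale (\<Prod>j\<in>{1..m}. of_nat j - of_nat l) x"
proof (induction m)
  case (Suc m)
  then show ?case
    by (simp add: rho_scale[OF height_mat_in_sl] assms mult.commute
        flip: scale_left_diff_distrib right_diff_distrib)
      (simp add: algebra_simps)
qed simp

lemma top_proj_top:
  assumes "\<rho> (height_mat n) x = scale c x"
  shows "top_proj c m x = scale (fact m) x"
  using top_proj_eigen[of x c 0 m] assms by (simp add: fact_prod)

text \<open>An element of the cyclic submodule is a finite combination of words. Once
  \<open>m\<close> reaches their heights, the factor with \<open>j = l\<close> kills every word of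
  positive height \<open>l\<close>, and only multiples of \<open>v\<close> remain.\<close>

lemma top_proj_cyclic:
  assumes v: "\<rho> (height_mat n) v = scale c v" and x: "x \<in> cyclic v"
  shows "\<exists>m0. \<forall>m\<ge>m0. \<exists>d. top_proj c m x = scale d v"
  using x unfolding cyclic_def
proof (induction rule: span_induct_alt)
  case base
  show ?case
    by (rule exI[of _ 0]) (auto simp: top_proj_zero intro: exI[of _ 0])
next
  case (step e x y)
  obtain l where l: "lowering_word v l x"
    using step by auto
  obtain m0 where m0: "\<And>m. m \<ge> m0 \<Longrightarrow> \<exists>d. top_proj c m y = scale d v"
    using step by auto
  have "\<exists>d. top_proj c m (scale e x + y) = scale d v" if m: "m \<ge> max l m0" for m
  proof -
    obtain d where d: "top_proj c m y = scale d v"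
      using m0 m by auto
    have "\<exists>d. top_proj c m x = scale d v"
    proof (cases "l = 0")
      case True
      \<comment> \<open>Each letter contributes \<open>i - j > 0\<close>, so a word of height 0 is
        empty.\<close>
      from l have "lowering_word v l x \<longrightarrow> l = 0 \<longrightarrow> x = v"
        by (induction rule: lowering_word.induct) auto
      then show ?thesis
        using l True top_proj_top[OF v] by blast
    next
      case False
      then have "(\<Prod>j\<in>{1..m}. of_nat j - of_nat l :: complex) = 0"
        using m by (intro prod_zero) (auto intro!: bexI[of _ l])
      then show ?thesis
        using top_proj_eigen[OF lowering_word_height[OF l v], of m]
        by (auto intro: exI[of _ 0])
    qed
    then obtain d' where "top_proj c m x = scale d' v" ..
    then have "top_proj c m (scale e x + y) = scale (e * d' + d) v"
      using d by (simp add: top_proj_add top_proj_scale scale_left_distrib)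
    then show ?thesis ..
  qed
  then show ?case by blast
qed

end

section \<open>The Fock space and the Koszul differential\<close>

text \<open>\<open>f b S\<close> is the coefficient of \<open>x\<^sup>b \<otimes> e\<^sub>S\<close>, with \<open>e\<^sub>S\<close> the wedge product in increasing order. No
  finiteness of the support is imposed.\<close>

type_synonym fock = "(nat \<Rightarrow> nat) \<Rightarrow> nat set \<Rightarrow> complex"

definition fscale :: "complex \<Rightarrow> fock \<Rightarrow> fock" where
  "fscale c f = (\<lambda>b S. c * f b S)"

lemma fscale_apply: "fscale c f b S = c * f b S"
  by (simp add: fscale_def)

text \<open>The sign of moving e_i past the factors of e_S with smaller index.\<close>

definition fsign :: "nat \<Rightarrow> nat set \<Rightarrow> complex" where
  "fsign i S = (- 1) ^ card {s \<in> S. s < i}"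

text \<open>Multiplication by x_i, the derivative by x_i, exterior multiplication by e_i and
  contraction with e_i, written on coefficient functions: each reads \<open>f\<close> at the index
  whose monomial is sent to the monomial of \<open>(b, S)\<close>.\<close>

definition bcre :: "nat \<Rightarrow> fock \<Rightarrow> fock" where
  "bcre i f = (\<lambda>b S. if b i = 0 then 0 else f (b(i := b i - 1)) S)"

definition bann :: "nat \<Rightarrow> fock \<Rightarrow> fock" where
  "bann i f = (\<lambda>b S. of_nat (b i + 1) * f (b(i := b i + 1)) S)"

definition fcre :: "nat \<Rightarrow> fock \<Rightarrow> fock" where
  "fcre i f = (\<lambda>b S. if i \<in> S then fsign i S * f b (S - {i}) else 0)"

definition fann :: "nat \<Rightarrow> fock \<Rightarrow> fock" where
  "fann i f = (\<lambda>b S. if i \<in> S then 0 else fsign i S * f b (insert i S))"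

definition gl_op :: "nat \<Rightarrow> nat \<Rightarrow> fock \<Rightarrow> fock" where
  "gl_op i j f = bcre i (bann j f) + fcre i (fann j f)"

definition koszul :: "nat \<Rightarrow> fock \<Rightarrow> fock" where
  "koszul n f = (\<Sum>i\<le>n. bcre i (fann i f))"

lemma sum_fock_apply: "(\<Sum>x\<in>A. f x) b S = (\<Sum>x\<in>A. f x b S)" for f :: "'a \<Rightarrow> fock"
  by (induction A rule: infinite_finite_induct) auto

interpretation fock: vector_space fscale
  by unfold_locales (auto simp: fscale_def fun_eq_iff algebra_simps)

lemma fsign_sq: "fsign i S * fsign i S = 1"
  by (simp add: fsign_def flip: power_add)

lemma fsign_nonzero: "fsign i S \<noteq> 0"
  by (simp add: fsign_def)

lemma fsign_self [simp]: "fsign i (insert i S) = fsign i S" "fsign i (S - {i}) = fsign i S"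
  unfolding fsign_def by (rule arg_cong[of _ _ "\<lambda>A. (- 1) ^ card A"], auto)+

lemma fsign_insert:
  assumes "j \<notin> S"
  shows "fsign i (insert j S) = (if j < i then - fsign i S else fsign i S)"
proof (cases "j < i")
  case True
  then have "{s \<in> insert j S. s < i} = insert j {s \<in> S. s < i}"
    by auto
  then show ?thesis
    using assms True by (simp add: fsign_def)
next
  case False
  then have "{s \<in> insert j S. s < i} = {s \<in> S. s < i}"
    by auto
  then show ?thesis
    using False by (simp add: fsign_def)
qed

lemma fsign_remove:
  assumes "j \<in> S"
  shows "fsign i (S - {j}) = (if j < i then - fsign i S else fsign i S)"
  using fsign_insert[of j "S - {j}" i] assms by (auto simp: insert_absorb)

section \<open>Linearity of the four operators and the canonical (anti)commutation relations\<close>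

lemma op_add:
  "bcre i (f + g) = bcre i f + bcre i g" "bann i (f + g) = bann i f + bann i g"
  "fcre i (f + g) = fcre i f + fcre i g" "fann i (f + g) = fann i f + fann i g"
  by (auto simp: bcre_def bann_def fcre_def fann_def fun_eq_iff algebra_simps)

lemma op_fscale:
  "bcre i (fscale c f) = fscale c (bcre i f)" "bann i (fscale c f) = fscale c (bann i f)"
  "fcre i (fscale c f) = fscale c (fcre i f)" "fann i (fscale c f) = fscale c (fann i f)"
  by (auto simp: bcre_def bann_def fcre_def fann_def fscale_def fun_eq_iff)

lemma op_uminus:
  "bcre i (- f) = - bcre i f" "bann i (- f) = - bann i f"
  "fcre i (- f) = - fcre i f" "fann i (- f) = - fann i f"
  by (auto simp: bcre_def bann_def fcre_def fann_def fun_eq_iff)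

lemma op_diff:
  "bcre i (f - g) = bcre i f - bcre i g" "bann i (f - g) = bann i f - bann i g"
  "fcre i (f - g) = fcre i f - fcre i g" "fann i (f - g) = fann i f - fann i g"
  by (auto simp: bcre_def bann_def fcre_def fann_def fun_eq_iff algebra_simps)

lemma op_zero: "bcre i 0 = 0" "bann i 0 = 0" "fcre i 0 = 0" "fann i 0 = 0"
  by (auto simp: bcre_def bann_def fcre_def fann_def fun_eq_iff)

lemma op_sum:
  "bcre i (\<Sum>x\<in>A. f x) = (\<Sum>x\<in>A. bcre i (f x))"
  "bann i (\<Sum>x\<in>A. f x) = (\<Sum>x\<in>A. bann i (f x))"
  "fcre i (\<Sum>x\<in>A. f x) = (\<Sum>x\<in>A. fcre i (f x))"
  "fann i (\<Sum>x\<in>A. f x) = (\<Sum>x\<in>A. fann i (f x))"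
  by (induction A rule: infinite_finite_induct) (auto simp: op_zero op_add)

lemma bcre_commute: "bcre i (bcre j f) = bcre j (bcre i f)"
  by (auto simp: bcre_def fun_eq_iff fun_upd_twist)

lemma bann_commute: "bann i (bann j f) = bann j (bann i f)"
  by (cases "i = j") (auto simp: bann_def fun_eq_iff fun_upd_twist)

lemma bann_bcre: "bann i (bcre j f) = bcre j (bann i f) + (if i = j then f else 0)"
  by (cases "i = j") (auto simp: bann_def bcre_def fun_eq_iff fun_upd_twist algebra_simps)

lemma bos_ferm_commute:
  "fcre i (bcre j f) = bcre j (fcre i f)" "fann i (bcre j f) = bcre j (fann i f)"
  "fcre i (bann j f) = bann j (fcre i f)" "fann i (bann j f) = bann j (fann i f)"
  by (auto simp: bcre_def bann_def fcre_def fann_def fun_eq_iff)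

lemma fann_anticommute: "fann i (fann j f) = - fann j (fann i f)"
  by (cases i j rule: linorder_cases)
    (auto simp: fann_def fun_eq_iff fsign_insert insert_commute)

lemma fcre_anticommute: "fcre i (fcre j f) = - fcre j (fcre i f)"
proof (cases "i = j")
  case False
  have "S - {i} - {j} = S - {j} - {i}" for S by auto
  then show ?thesis
    using False by (cases i j rule: linorder_cases)
      (auto simp: fcre_def fun_eq_iff fsign_remove)
qed (auto simp: fcre_def fun_eq_iff)

lemma fann_fcre: "fann i (fcre j f) = (if i = j then f else 0) - fcre j (fann i f)"
proof (cases "i = j")
  case True
  have "fsign j S * (fsign j S * c) = c" for S and c
    using fsign_sq[of j S] by (metis mult.assoc mult_1)
  with True show ?thesis
    by (auto simp: fann_def fcre_def fun_eq_iff insert_absorb)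
next
  case False
  have *: "insert i S - {j} = insert i (S - {j})" for S
    using False by auto
  show ?thesis
    using False by (cases i j rule: linorder_cases)
      (auto simp: fann_def fcre_def fun_eq_iff fsign_insert fsign_remove *)
qed

lemma gl_op_add: "gl_op i j (f + g) = gl_op i j f + gl_op i j g"
  by (simp add: gl_op_def op_add)

lemma gl_op_fscale: "gl_op i j (fscale c f) = fscale c (gl_op i j f)"
  by (simp add: gl_op_def op_fscale fock.scale_right_distrib)

lemma gl_op_sum: "gl_op i j (\<Sum>x\<in>A. f x) = (\<Sum>x\<in>A. gl_op i j (f x))"
  by (simp add: gl_op_def op_sum sum.distrib)

text \<open>The bosonic and the fermionic halves satisfy the relations of the matrix units
  separately, and mixed terms commute.\<close>

lemma gl_op_commutator:
  "gl_op i j (gl_op r s f) - gl_op r s (gl_op i j f) =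
    (if j = r then gl_op i s f else 0) - (if s = i then gl_op r j f else 0)"
proof -
  have b: "bcre i (bann j (bcre r (bann s f))) - bcre r (bann s (bcre i (bann j f))) =
      (if j = r then bcre i (bann s f) else 0) - (if s = i then bcre r (bann j f) else 0)"
    by (simp add: bann_bcre op_add op_zero bcre_commute[of i r] bann_commute[of j s])
  \<comment> \<open>Two anticommutations, one of creators and one of annihilators, whose signs
    cancel; hence the quartic terms drop out of the commutator.\<close>
  have "fcre i (fcre r (fann j (fann s f))) = fcre r (fcre i (fann s (fann j f)))"
    by (simp add: fcre_anticommute[of i r] fann_anticommute[of j s] op_uminus)
  then have f: "fcre i (fann j (fcre r (fann s f))) - fcre r (fann s (fcre i (fann j f))) =
      (if j = r then fcre i (fann s f) else 0) - (if s = i then fcre r (fann j f) else 0)"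
    by (simp add: fann_fcre op_diff op_zero)
  have "gl_op i j (gl_op r s f) - gl_op r s (gl_op i j f) =
     (bcre i (bann j (bcre r (bann s f))) - bcre r (bann s (bcre i (bann j f)))) +
     (fcre i (fann j (fcre r (fann s f))) - fcre r (fann s (fcre i (fann j f))))"
    by (simp add: gl_op_def op_add bos_ferm_commute)
  then show ?thesis
    unfolding b f by (simp add: gl_op_def)
qed

lemma koszul_add: "koszul n (f + g) = koszul n f + koszul n g"
  by (simp add: koszul_def op_add sum.distrib)

lemma koszul_fscale: "koszul n (fscale c f) = fscale c (koszul n f)"
  by (simp add: koszul_def op_fscale fock.scale_sum_right)

lemma koszul_zero: "koszul n 0 = 0"
  by (simp add: koszul_def op_zero)

lemma koszul_sum: "koszul n (\<Sum>x\<in>A. f x) = (\<Sum>x\<in>A. koszul n (f x))"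
  unfolding koszul_def op_sum by (rule sum.swap)

text \<open>A single summand of the differential need not commute with \<open>gl_op i j\<close>, but
  the corrections from \<open>l = i\<close> and \<open>l = j\<close> cancel in the sum.\<close>

lemma koszul_gl_op:
  assumes "i \<le> n" "j \<le> n"
  shows "koszul n (gl_op i j f) = gl_op i j (koszul n f)"
proof -
  have "bcre l (fann l (gl_op i j f)) =
      gl_op i j (bcre l (fann l f)) + ((if l = i then bcre l (fann j f) else 0) -
        (if l = j then bcre i (fann l f) else 0))" for l
    by (auto simp: gl_op_def op_add op_diff op_zero bos_ferm_commute bann_bcre fann_fcre
        bcre_commute[of l i] fann_anticommute[of l j] op_uminus)
  then show ?thesis
    using assms by (simp add: koszul_def gl_op_sum sum.distrib sum_subtractf)
qed

text \<open>The x_i commute and the contractions anticommute, so exchanging the two summation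
  indices shows that the double sum is its own negative.\<close>

lemma koszul_koszul: "koszul n (koszul n f) = 0"
proof -
  let ?s = "\<Sum>i\<le>n. \<Sum>j\<le>n. bcre i (bcre j (fann i (fann j f)))"
  have "?s = (\<Sum>j\<le>n. \<Sum>i\<le>n. bcre i (bcre j (fann i (fann j f))))"
    by (rule sum.swap)
  also have "\<dots> = (\<Sum>j\<le>n. \<Sum>i\<le>n. - bcre j (bcre i (fann j (fann i f))))"
    by (intro sum.cong refl)
      (metis bcre_commute fann_anticommute op_uminus(1))
  also have "\<dots> = - ?s"
    by (simp add: sum_negf)
  finally have s: "?s = - ?s" .
  have "?s b S = 0" for b S
    using fun_cong[OF fun_cong[OF s, of b], of S] by simp
  then have "?s = 0"
    by (intro ext) simp
  then show ?thesis
    by (simp add: koszul_def op_sum bos_ferm_commute)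
qed

section \<open>The Fock space as a representation of sl(n+1)\<close>

definition fock_rho :: "nat \<Rightarrow> cmat \<Rightarrow> fock \<Rightarrow> fock" where
  "fock_rho n X f = (\<Sum>i\<le>n. \<Sum>j\<le>n. fscale (X i j) (gl_op i j f))"

text \<open>The bilinear extension of \<open>gl_op_commutator\<close>: its two Kronecker deltas
  collapse the fourfold sums to the entries of XY and of YX.\<close>

lemma fock_rho_bracket:
  "fock_rho n (lie_bracket n X Y) f =
    fock_rho n X (fock_rho n Y f) - fock_rho n Y (fock_rho n X f)"
proof -
  have comp: "fock_rho n X (fock_rho n Y f) = (\<Sum>i\<le>n. \<Sum>j\<le>n. \<Sum>r\<le>n. \<Sum>s\<le>n.
      fscale (X i j * Y r s) (gl_op i j (gl_op r s f)))" for X Y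
    by (simp add: fock_rho_def gl_op_sum gl_op_fscale fock.scale_sum_right)
  have swap: "(\<Sum>i\<le>n. \<Sum>j\<le>n. \<Sum>r\<le>n. \<Sum>s\<le>n. g i j r s) =
      (\<Sum>r\<le>n. \<Sum>s\<le>n. \<Sum>i\<le>n. \<Sum>j\<le>n. g i j r s)" for g :: "nat \<Rightarrow> nat \<Rightarrow> nat \<Rightarrow> nat \<Rightarrow> fock"
    using sum.swap[of "\<lambda>x y. g (fst x) (snd x) (fst y) (snd y)" "{..n} \<times> {..n}" "{..n} \<times> {..n}"]
    by (simp add: sum.cartesian_product')
  have "fock_rho n X (fock_rho n Y f) - fock_rho n Y (fock_rho n X f) =
     (\<Sum>i\<le>n. \<Sum>j\<le>n. \<Sum>r\<le>n. \<Sum>s\<le>n. fscale (X i j * Y r s)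
        (gl_op i j (gl_op r s f) - gl_op r s (gl_op i j f)))"
    unfolding comp swap[of "\<lambda>i j r s. fscale (Y i j * X r s) (gl_op i j (gl_op r s f))"]
    by (simp add: sum_subtractf fock.scale_right_diff_distrib mult.commute)
  also have "\<dots> = (\<Sum>i\<le>n. \<Sum>j\<le>n. \<Sum>r\<le>n. \<Sum>s\<le>n.
        (if j = r then fscale (X i j * Y r s) (gl_op i s f) else 0)) -
      (\<Sum>i\<le>n. \<Sum>j\<le>n. \<Sum>r\<le>n. \<Sum>s\<le>n.
        (if s = i then fscale (X i j * Y r s) (gl_op r j f) else 0))"
    unfolding gl_op_commutator sum_subtractf[symmetric]
    by (intro sum.cong refl) (auto simp: fock.scale_right_diff_distrib)
  also have "(\<Sum>i\<le>n. \<Sum>j\<le>n. \<Sum>r\<le>n. \<Sum>s\<le>n.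
        (if j = r then fscale (X i j * Y r s) (gl_op i s f) else 0)) =
      (\<Sum>i\<le>n. \<Sum>s\<le>n. fscale (mat_mul n X Y i s) (gl_op i s f))"
  proof (rule sum.cong[OF refl])
    fix i
    have "(\<Sum>j\<le>n. \<Sum>r\<le>n. \<Sum>s\<le>n. if j = r then fscale (X i j * Y r s) (gl_op i s f) else 0) =
        (\<Sum>j\<le>n. \<Sum>s\<le>n. fscale (X i j * Y j s) (gl_op i s f))"
    proof (rule sum.cong[OF refl])
      fix j assume "j \<in> {..n}"
      then show "(\<Sum>r\<le>n. \<Sum>s\<le>n. if j = r then fscale (X i j * Y r s) (gl_op i s f) else 0) =
          (\<Sum>s\<le>n. fscale (X i j * Y j s) (gl_op i s f))"
        by (subst sum.swap) (simp add: sum.delta')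
    qed
    also have "\<dots> = (\<Sum>s\<le>n. fscale (mat_mul n X Y i s) (gl_op i s f))"
      by (subst sum.swap) (simp add: mat_mul_def fock.scale_sum_left)
    finally show "(\<Sum>j\<le>n. \<Sum>r\<le>n. \<Sum>s\<le>n.
        if j = r then fscale (X i j * Y r s) (gl_op i s f) else 0) =
      (\<Sum>s\<le>n. fscale (mat_mul n X Y i s) (gl_op i s f))" .
  qed
  also have "(\<Sum>i\<le>n. \<Sum>j\<le>n. \<Sum>r\<le>n. \<Sum>s\<le>n.
        (if s = i then fscale (X i j * Y r s) (gl_op r j f) else 0)) =
      (\<Sum>r\<le>n. \<Sum>j\<le>n. fscale (mat_mul n Y X r j) (gl_op r j f))"
  proof -
    have "(\<Sum>i\<le>n. \<Sum>j\<le>n. \<Sum>r\<le>n. \<Sum>s\<le>n.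
        (if s = i then fscale (X i j * Y r s) (gl_op r j f) else 0)) =
        (\<Sum>i\<le>n. \<Sum>j\<le>n. \<Sum>r\<le>n. fscale (Y r i * X i j) (gl_op r j f))"
      by (intro sum.cong refl) (simp add: mult.commute)
    also have "\<dots> = (\<Sum>i\<le>n. \<Sum>r\<le>n. \<Sum>j\<le>n. fscale (Y r i * X i j) (gl_op r j f))"
      by (intro sum.cong refl sum.swap)
    also have "\<dots> = (\<Sum>r\<le>n. \<Sum>i\<le>n. \<Sum>j\<le>n. fscale (Y r i * X i j) (gl_op r j f))"
      by (rule sum.swap)
    also have "\<dots> = (\<Sum>r\<le>n. \<Sum>j\<le>n. \<Sum>i\<le>n. fscale (Y r i * X i j) (gl_op r j f))"
      by (intro sum.cong refl sum.swap)
    finally show ?thesis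
      by (simp add: mat_mul_def fock.scale_sum_left)
  qed
  also have "(\<Sum>i\<le>n. \<Sum>s\<le>n. fscale (mat_mul n X Y i s) (gl_op i s f)) -
      (\<Sum>r\<le>n. \<Sum>j\<le>n. fscale (mat_mul n Y X r j) (gl_op r j f)) =
      fock_rho n (lie_bracket n X Y) f"
    by (simp add: fock_rho_def lie_bracket_def fock.scale_left_diff_distrib sum_subtractf)
  finally show ?thesis
    by (rule sym)
qed

interpretation fock: sl_rep fscale n "fock_rho n" for n
proof unfold_locales
  fix X Y :: cmat and c f g
  show "fock_rho n X (f + g) = fock_rho n X f + fock_rho n X g"
    by (simp add: fock_rho_def gl_op_add fock.scale_right_distrib sum.distrib)
  show "fock_rho n X (fscale c f) = fscale c (fock_rho n X f)"
    by (simp add: fock_rho_def gl_op_fscale fock.scale_sum_right mult.commute)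
  show "fock_rho n (\<lambda>i j. X i j + Y i j) f = fock_rho n X f + fock_rho n Y f"
    by (simp add: fock_rho_def fock.scale_left_distrib sum.distrib)
  show "fock_rho n (\<lambda>i j. c * X i j) f = fscale c (fock_rho n X f)"
    by (simp add: fock_rho_def fock.scale_sum_right)
  show "fock_rho n (lie_bracket n X Y) f =
      fock_rho n X (fock_rho n Y f) - fock_rho n Y (fock_rho n X f)"
    by (rule fock_rho_bracket)
qed

lemma fock_rho_elem_mat:
  assumes "i \<le> n" "j \<le> n"
  shows "fock_rho n (elem_mat i j) f = gl_op i j f"
proof -
  have "fock_rho n (elem_mat i j) f =
      (\<Sum>r\<le>n. if r = i then \<Sum>s\<le>n. if s = j then gl_op r s f else 0 else 0)"
    unfolding fock_rho_def
  proof (intro sum.cong refl)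
    fix r
    have "fscale (elem_mat i j r s) g = (if r = i then if s = j then g else 0 else 0)" for s g
      by (simp add: elem_mat_def)
    then show "(\<Sum>s\<le>n. fscale (elem_mat i j r s) (gl_op r s f)) =
        (if r = i then \<Sum>s\<le>n. if s = j then gl_op r s f else 0 else 0)"
      by (cases "r = i") (simp_all only: refl if_True if_False sum.neutral_const)
  qed
  then show ?thesis
    using assms by simp
qed

text \<open>The sum of the bosonic and fermionic number operators, diagonal in the monomial
  basis.\<close>

lemma gl_op_diag: "gl_op i i f b S = of_nat (b i + of_bool (i \<in> S)) * f b S"
proof -
  have "fsign i S * (fsign i S * c) = c" for c
    using fsign_sq[of i S] by (metis mult.assoc mult_1)
  then show ?thesis
    by (auto simp: gl_op_def bcre_def bann_def fcre_def fann_def insert_absorb algebra_simps)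
qed

lemma fock_rho_cartan:
  assumes "H \<in> cartan n"
  shows "fock_rho n H f b S = (\<Sum>i\<le>n. of_nat (b i + of_bool (i \<in> S)) * H i i) * f b S"
proof -
  have "fock_rho n H f = (\<Sum>i\<le>n. \<Sum>j\<le>n. if j = i then fscale (H i i) (gl_op i i f) else 0)"
    unfolding fock_rho_def using assms by (intro sum.cong refl) (auto simp: cartan_def)
  also have "\<dots> = (\<Sum>i\<le>n. fscale (H i i) (gl_op i i f))"
    by simp
  finally show ?thesis
    by (simp add: sum_fock_apply fscale_def gl_op_diag sum_distrib_left mult_ac)
qed

section \<open>The bigraded pieces of the Fock space\<close>

definition bidx :: "nat \<Rightarrow> nat \<Rightarrow> (nat \<Rightarrow> nat) set" where
  "bidx n q = {b. (\<forall>i>n. b i = 0) \<and> (\<Sum>i\<le>n. b i) = q}"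

text \<open>The tensor product of Sym^q and Lambda^s. Its index set is finite, so finite sums such
  as \<open>fock_ip\<close> see all of \<open>f\<close>.\<close>

definition fock_part :: "nat \<Rightarrow> nat \<Rightarrow> nat \<Rightarrow> fock set" where
  "fock_part n q s = {f. \<forall>b S. f b S \<noteq> 0 \<longrightarrow> b \<in> bidx n q \<and> S \<subseteq> {..n} \<and> card S = s}"

lemma sum_fun_upd:
  fixes b :: "nat \<Rightarrow> nat"
  assumes "i \<le> n"
  shows "(\<Sum>l\<le>n. (b(i := x)) l) + b i = (\<Sum>l\<le>n. b l) + x"
proof -
  have "(\<Sum>l\<in>{..n} - {i}. (b(i := x)) l) = (\<Sum>l\<in>{..n} - {i}. b l)"
    by (rule sum.cong) auto
  then show ?thesis
    using assms by (simp add: sum.remove[of "{..n}" i])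
qed

lemma bidx_incr:
  assumes "i \<le> n"
  shows "b(i := b i + 1) \<in> bidx n (Suc q) \<longleftrightarrow> b \<in> bidx n q"
  using sum_fun_upd[OF assms, of b "b i + 1"] assms by (auto simp: bidx_def)

lemma bidx_decr:
  assumes "i \<le> n" "b i \<noteq> 0"
  shows "b(i := b i - 1) \<in> bidx n q \<longleftrightarrow> b \<in> bidx n (Suc q)"
  using bidx_incr[of i n "b(i := b i - 1)" q] assms by auto

lemma finite_bidx: "finite (bidx n q)"
proof -
  have "b i \<le> (\<Sum>l\<le>n. b l)" if "i \<le> n" for b :: "nat \<Rightarrow> nat" and i
    using that by (intro member_le_sum) auto
  then have "bidx n q \<subseteq> {b. \<forall>i. (i \<in> {..n} \<longrightarrow> b i \<in> {..q}) \<and> (i \<notin> {..n} \<longrightarrow> b i = 0)}"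
    by (auto simp: bidx_def)
  then show ?thesis
    by (rule finite_subset) (intro finite_set_of_finite_funs finite_atMost)
qed

lemma fock_part_subspace: "fock.subspace (fock_part n q s)"
  unfolding fock.subspace_def
proof (intro conjI ballI allI)
  fix f g assume fg: "f \<in> fock_part n q s" "g \<in> fock_part n q s"
  have "f b S \<noteq> 0 \<or> g b S \<noteq> 0" if "(f + g) b S \<noteq> 0" for b S
    using that by auto
  then show "f + g \<in> fock_part n q s"
    using fg unfolding fock_part_def by blast
next
  fix c f assume "f \<in> fock_part n q s"
  moreover have "f b S \<noteq> 0" if "fscale c f b S \<noteq> 0" for b S
    using that by (auto simp: fscale_def)
  ultimately show "fscale c f \<in> fock_part n q s"
    unfolding fock_part_def by blast
qed (auto simp: fock_part_def)

text \<open>The degree is written \<open>Suc q\<close> because the bosonic half passes through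
  degree \<open>q\<close>.\<close>

lemma fock_part_gl_op:
  assumes f: "f \<in> fock_part n (Suc q) s" and ij: "i \<le> n" "j \<le> n"
  shows "gl_op i j f \<in> fock_part n (Suc q) s"
proof -
  have "bcre i (bann j f) \<in> fock_part n (Suc q) s"
    unfolding fock_part_def
  proof (intro CollectI allI impI)
    fix b S assume "bcre i (bann j f) b S \<noteq> 0"
    then have b: "b i \<noteq> 0" and "f ((b(i := b i - 1))(j := (b(i := b i - 1)) j + 1)) S \<noteq> 0"
      by (auto simp: bcre_def bann_def split: if_splits)
    then have "(b(i := b i - 1))(j := (b(i := b i - 1)) j + 1) \<in> bidx n (Suc q)"
        "S \<subseteq> {..n} \<and> card S = s"
      using f unfolding fock_part_def by blast+
    then show "b \<in> bidx n (Suc q) \<and> S \<subseteq> {..n} \<and> card S = s"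
      using bidx_incr[OF ij(2)] bidx_decr[of i n b, OF ij(1) b] by blast
  qed
  moreover have "fcre i (fann j f) \<in> fock_part n (Suc q) s"
    unfolding fock_part_def
  proof (intro CollectI allI impI)
    fix b S assume "fcre i (fann j f) b S \<noteq> 0"
    then have S: "i \<in> S" "j \<notin> S - {i}" and "f b (insert j (S - {i})) \<noteq> 0"
      by (auto simp: fcre_def fann_def split: if_splits)
    then have b: "b \<in> bidx n (Suc q)" and T: "insert j (S - {i}) \<subseteq> {..n}"
        "card (insert j (S - {i})) = s"
      using f unfolding fock_part_def by blast+
    have fin: "finite (S - {i})"
      using T(1) by (metis finite_atMost finite_subset insert_subset)
    then have "card S = s"
      using T(2) S card_Suc_Diff1[of S i] by simp
    moreover have "S \<subseteq> {..n}"
      using T(1) ij by auto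
    ultimately show "b \<in> bidx n (Suc q) \<and> S \<subseteq> {..n} \<and> card S = s"
      using b by blast
  qed
  ultimately show ?thesis
    unfolding gl_op_def using fock.subspace_add[OF fock_part_subspace] by blast
qed

lemma fock_part_rho:
  assumes "f \<in> fock_part n (Suc q) s"
  shows "fock_rho n X f \<in> fock_part n (Suc q) s"
  unfolding fock_rho_def
  by (intro fock.subspace_sum[OF fock_part_subspace] fock.subspace_scale[OF fock_part_subspace]
      fock_part_gl_op assms) auto

section \<open>A contravariant Hermitian inner product\<close>

text \<open>The weight \<open>\<Prod> b\<^sub>i!\<close> makes multiplication by \<open>x\<^sub>i\<close> adjoint to \<open>\<partial>\<^sub>i\<close>.\<close>

definition bweight :: "nat \<Rightarrow> (nat \<Rightarrow> nat) \<Rightarrow> real" where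
  "bweight n b = (\<Prod>i\<le>n. fact (b i))"

lemma bweight_pos: "bweight n b > 0"
  by (auto simp: bweight_def intro: prod_pos)

lemma bweight_incr:
  assumes "i \<le> n"
  shows "bweight n (b(i := b i + 1)) = bweight n b * (b i + 1)"
proof -
  have "(\<Prod>l\<in>{..n} - {i}. fact ((b(i := b i + 1)) l)) = (\<Prod>l\<in>{..n} - {i}. fact (b l) :: real)"
    by (rule prod.cong) auto
  then show ?thesis
    using assms by (simp add: bweight_def prod.remove[of "{..n}" i])
qed

text \<open>Linear in the first argument. Only indices of polynomial degree \<open>q\<close> enter,
  so it is definite on functions supported there.\<close>

definition fock_ip :: "nat \<Rightarrow> nat \<Rightarrow> fock \<Rightarrow> fock \<Rightarrow> complex" where
  "fock_ip n q f g =
    (\<Sum>b\<in>bidx n q. \<Sum>S\<in>Pow {..n}. of_real (bweight n b) * f b S * cnj (g b S))"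

lemma cnj_fsign [simp]: "cnj (fsign i S) = fsign i S"
  by (simp add: fsign_def)

lemma fock_ip_cnj: "cnj (fock_ip n q f g) = fock_ip n q g f"
  by (simp add: fock_ip_def mult_ac)

lemma fock_ip_add_left: "fock_ip n q (f + g) h = fock_ip n q f h + fock_ip n q g h"
  by (simp add: fock_ip_def algebra_simps sum.distrib)

lemma fock_ip_add_right: "fock_ip n q h (f + g) = fock_ip n q h f + fock_ip n q h g"
  by (simp add: fock_ip_def algebra_simps sum.distrib)

lemma fock_ip_fscale_left: "fock_ip n q (fscale c f) h = c * fock_ip n q f h"
  by (simp add: fock_ip_def fscale_def sum_distrib_left mult_ac)

lemma fock_ip_zero_left: "fock_ip n q 0 h = 0"
  by (simp add: fock_ip_def)

lemma fock_ip_self: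
  assumes "f \<in> fock_part n q s" "fock_ip n q f f = 0"
  shows "f = 0"
proof -
  define r where "r = (\<Sum>b\<in>bidx n q. \<Sum>S\<in>Pow {..n}. bweight n b * (cmod (f b S))\<^sup>2)"
  have "fock_ip n q f f = of_real r"
    by (simp only: fock_ip_def r_def mult.assoc complex_norm_square[symmetric] of_real_mult
        of_real_sum)
  then have "r = 0"
    using assms(2) by simp
  then have z: "(\<Sum>b\<in>bidx n q. \<Sum>S\<in>Pow {..n}. bweight n b * (cmod (f b S))\<^sup>2) = 0"
    by (simp add: r_def)
  have nn: "bweight n b * (cmod (f b S))\<^sup>2 \<ge> 0" for b S
    using bweight_pos[of n b] by simp
  have "f b S = 0" for b S
  proof (rule ccontr)
    assume ne: "f b S \<noteq> 0"
    then have b: "b \<in> bidx n q" "S \<in> Pow {..n}"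
      using assms(1) by (auto simp: fock_part_def)
    have "(\<Sum>S\<in>Pow {..n}. bweight n b * (cmod (f b S))\<^sup>2) = 0"
      using z b nn by (subst (asm) sum_nonneg_eq_0_iff) (auto simp: finite_bidx intro!: sum_nonneg)
    then have "bweight n b * (cmod (f b S))\<^sup>2 = 0"
      using b nn by (subst (asm) sum_nonneg_eq_0_iff) auto
    then show False
      using ne bweight_pos[of n b] by simp
  qed
  then show ?thesis
    by (intro ext) simp
qed

text \<open>Shift the summation index by one in coordinate \<open>i\<close>: the factor gained by
  \<open>bweight\<close> is exactly the one that the derivative produces.\<close>

lemma fock_ip_bcre:
  assumes i: "i \<le> n"
  shows "fock_ip n (Suc q) (bcre i f) g = fock_ip n q f (bann i g)"
proof -
  let ?G = "\<lambda>b. \<Sum>S\<in>Pow {..n}. of_real (bweight n b) * bcre i f b S * cnj (g b S)"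
  have "(\<Sum>b\<in>bidx n (Suc q). ?G b) = (\<Sum>b\<in>{b \<in> bidx n (Suc q). b i \<noteq> 0}. ?G b)"
    by (rule sum.mono_neutral_right) (auto simp: finite_bidx bcre_def)
  also have "\<dots> = (\<Sum>b\<in>bidx n q. \<Sum>S\<in>Pow {..n}. of_real (bweight n b) * f b S * cnj (bann i g b S))"
  proof (rule sum.reindex_bij_witness[of _ "\<lambda>b. b(i := b i + 1)" "\<lambda>b. b(i := b i - 1)"])
    fix b assume b: "b \<in> {b \<in> bidx n (Suc q). b i \<noteq> 0}"
    then show "b(i := b i - 1) \<in> bidx n q"
      using bidx_decr[OF i] by auto
    have "bweight n b = bweight n (b(i := b i - 1)) * (real (b i - 1) + 1)"
      using bweight_incr[OF i, of "b(i := b i - 1)"] b by auto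
    then show "(\<Sum>S\<in>Pow {..n}. of_real (bweight n (b(i := b i - 1))) * f (b(i := b i - 1)) S *
        cnj (bann i g (b(i := b i - 1)) S)) = ?G b"
      using b by (intro sum.cong refl) (auto simp: bcre_def bann_def)
  next
    fix b assume b: "b \<in> bidx n q"
    then show "b(i := b i + 1) \<in> {b \<in> bidx n (Suc q). b i \<noteq> 0}"
      using bidx_incr[OF i] by auto
  qed auto
  finally show ?thesis
    by (simp add: fock_ip_def)
qed

text \<open>Sets containing \<open>i\<close> are paired with the same sets without \<open>i\<close>;
  both operators carry the same real sign there.\<close>

lemma fock_ip_fcre:
  assumes i: "i \<le> n"
  shows "fock_ip n q (fcre i f) g = fock_ip n q f (fann i g)"
proof -
  have "(\<Sum>S\<in>Pow {..n}. of_real (bweight n b) * fcre i f b S * cnj (g b S)) =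
      (\<Sum>S\<in>Pow {..n}. of_real (bweight n b) * f b S * cnj (fann i g b S))" (is "?l = ?r") for b
  proof -
    have "?l = (\<Sum>S\<in>{S \<in> Pow {..n}. i \<in> S}. of_real (bweight n b) * fcre i f b S * cnj (g b S))"
      by (rule sum.mono_neutral_right) (auto simp: fcre_def)
    also have "\<dots> = (\<Sum>S\<in>{S \<in> Pow {..n}. i \<notin> S}. of_real (bweight n b) * f b S * cnj (fann i g b S))"
      by (rule sum.reindex_bij_witness[of _ "insert i" "\<lambda>S. S - {i}"])
        (use i fsign_self(2)[of i] in \<open>auto simp: fcre_def fann_def insert_absorb\<close>)
    also have "\<dots> = ?r"
      by (rule sum.mono_neutral_left) (auto simp: fann_def)
    finally show ?thesis .
  qed
  then show ?thesis
    by (simp add: fock_ip_def)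
qed

lemma fock_ip_gl_op:
  assumes "i \<le> n" "j \<le> n"
  shows "fock_ip n (Suc q) (gl_op i j f) g = fock_ip n (Suc q) f (gl_op j i g)"
proof -
  have "fock_ip n (Suc q) (bcre i (bann j f)) g = cnj (fock_ip n q (bann i g) (bann j f))"
    using assms by (simp add: fock_ip_bcre fock_ip_cnj)
  also have "\<dots> = fock_ip n (Suc q) f (bcre j (bann i g))"
    using assms by (simp add: fock_ip_cnj flip: fock_ip_bcre)
  finally have b: "fock_ip n (Suc q) (bcre i (bann j f)) g =
      fock_ip n (Suc q) f (bcre j (bann i g))" .
  have "fock_ip n (Suc q) (fcre i (fann j f)) g = cnj (fock_ip n (Suc q) (fann i g) (fann j f))"
    using assms by (simp add: fock_ip_fcre fock_ip_cnj)
  also have "\<dots> = fock_ip n (Suc q) f (fcre j (fann i g))"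
    using assms by (simp add: fock_ip_cnj flip: fock_ip_fcre)
  finally show ?thesis
    using b by (simp add: gl_op_def fock_ip_add_left fock_ip_add_right)
qed

section \<open>Monomials and their generation from the highest weight one\<close>

definition fmono :: "(nat \<Rightarrow> nat) \<Rightarrow> nat set \<Rightarrow> fock" where
  "fmono b S = (\<lambda>b' S'. if b' = b \<and> S' = S then 1 else 0)"

lemma bcre_fmono: "bcre i (fmono b S) = fmono (b(i := b i + 1)) S"
  by (auto simp: bcre_def fmono_def fun_eq_iff)

lemma bann_fmono_zero: "b i = 0 \<Longrightarrow> bann i (fmono b S) = 0"
  by (auto simp: bann_def fmono_def fun_eq_iff)

lemma bann_bcre_fmono: "bann i (bcre i (fmono b S)) = fscale (of_nat (b i + 1)) (fmono b S)"
  by (auto simp: bann_def fmono_def bcre_def fscale_def fun_eq_iff)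

lemma fann_fmono: "fann i (fmono b S) = (if i \<in> S then fscale (fsign i S) (fmono b (S - {i})) else 0)"
  by (auto simp: fann_def fmono_def fscale_def fun_eq_iff)

lemma fcre_fmono: "fcre i (fmono b S) = (if i \<in> S then 0 else fscale (fsign i S) (fmono b (insert i S)))"
  by (auto simp: fcre_def fmono_def fscale_def fun_eq_iff insert_absorb)

lemma koszul_apply:
  "koszul n f b S = (\<Sum>i\<le>n. if b i = 0 \<or> i \<in> S then 0
     else fsign i S * f (b(i := b i - 1)) (insert i S))"
  unfolding koszul_def sum_fock_apply by (rule sum.cong) (auto simp: bcre_def fann_def)

lemma koszul_fock_part:
  assumes f: "f \<in> fock_part n q (Suc s)"
  shows "koszul n f \<in> fock_part n (Suc q) s"
  unfolding fock_part_def
proof (intro CollectI allI impI)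
  fix b S assume "koszul n f b S \<noteq> 0"
  then obtain i where i: "i \<le> n" "b i \<noteq> 0" "i \<notin> S" and "f (b(i := b i - 1)) (insert i S) \<noteq> 0"
    unfolding koszul_apply by (auto elim!: sum.not_neutral_contains_not_neutral split: if_splits)
  then have "b(i := b i - 1) \<in> bidx n q" "insert i S \<subseteq> {..n}" "card (insert i S) = Suc s"
    using f unfolding fock_part_def by blast+
  moreover from this(2) have "finite S"
    by (metis finite_atMost finite_subset insert_subset)
  ultimately show "b \<in> bidx n (Suc q) \<and> S \<subseteq> {..n} \<and> card S = s"
    using bidx_decr[of i n b q] i by simp
qed

text \<open>For \<open>g = x\<^sup>b \<otimes> e\<^sub>S\<close> with \<open>j \<notin> S\<close>, adding to \<open>d (e\<^sub>j \<and> g)\<close>, which \<open>d\<close> kills, the images of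
  \<open>x\<^sub>t g\<close> under the matrix units \<open>(j, t)\<close> for \<open>t \<in> S\<close> leaves a positive multiple of \<open>x\<^sub>j g\<close>. This
  drives the induction that produces every monomial from the highest weight one.\<close>

lemma koszul_fmono_generated:
  assumes sub: "fock.subspace M"
    and inv: "\<And>i j f. i \<le> n \<Longrightarrow> j \<le> n \<Longrightarrow> i \<noteq> j \<Longrightarrow> f \<in> M \<Longrightarrow> gl_op i j f \<in> M"
    and hw: "koszul n (fmono (\<lambda>i. if i = 0 then k else 0) {..<p}) \<in> M"
    and p: "1 \<le> p" "p \<le> n"
    and bS: "b \<in> bidx n k" "S \<subseteq> {..n}" "card S = p"
  shows "koszul n (fmono b S) \<in> M"
proof -
  \<comment> \<open>The argument runs in the preimage of \<open>M\<close>, which contains the image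
    of the differential since that squares to 0.\<close>
  define W where "W = {f. koszul n f \<in> M}"
  have Wsub: "fock.subspace W"
    unfolding fock.subspace_def W_def
    using fock.subspace_0[OF sub] fock.subspace_add[OF sub] fock.subspace_scale[OF sub]
    by (auto simp: koszul_zero koszul_add koszul_fscale)
  have Winv: "gl_op i j f \<in> W" if "i \<le> n" "j \<le> n" "i \<noteq> j" "f \<in> W" for i j f
    using that inv by (auto simp: W_def koszul_gl_op)
  have Wkos: "koszul n f \<in> W" for f
    using fock.subspace_0[OF sub] by (simp add: W_def koszul_koszul)
  have Wscale: "f \<in> W" if "fscale c f \<in> W" "c \<noteq> 0" for c f
    using fock.subspace_scale[OF Wsub that(1), of "inverse c"] that(2) by simp
  let ?S0 = "{..<p}"
  \<comment> \<open>First the exterior factor is held at \<open>?S0\<close>; the induction is on the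
    degree \<open>q\<close> in the variables other than x_0.\<close>
  have base: "fmono b ?S0 \<in> W" if "b 0 + q = k" "b \<in> bidx n k" for b q
    using that
  proof (induction q arbitrary: b)
    case 0
    have "(\<Sum>i\<in>{..n} - {0}. b i) = 0"
      using 0 by (simp add: bidx_def sum.remove[of "{..n}" 0])
    then have "\<forall>i\<in>{..n} - {0}. b i = 0"
      by simp
    then have "b i = (if i = 0 then k else 0)" for i
      using 0 by (cases "i \<le> n") (auto simp: bidx_def)
    then have "b = (\<lambda>i. if i = 0 then k else 0)"
      by blast
    then show ?case
      using hw by (simp add: W_def)
  next
    case (Suc q)
    have "\<exists>j\<in>{..n} - {0}. b j \<noteq> 0"
    proof (rule ccontr)
      assume "\<not> ?thesis"
      then have "(\<Sum>i\<in>{..n} - {0}. b i) = 0"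
        by simp
      then have "b 0 = k"
        using Suc.prems by (simp add: bidx_def sum.remove[of "{..n}" 0])
      then show False
        using Suc.prems by simp
    qed
    then obtain j where j: "j \<le> n" "j \<noteq> 0" "b j \<noteq> 0"
      by auto
    obtain k' where k': "k = Suc k'"
      using Suc.prems by (cases k) auto
    \<comment> \<open>One factor x_j is removed: the goal becomes x_j g, while the induction
      hypothesis applies to x_0 g, which has one more x_0.\<close>
    define b' where "b' = b(j := b j - 1)"
    define g where "g = fmono b' ?S0"
    have b': "b' \<in> bidx n k'"
      using bidx_decr[of j n b k', OF j(1,3)] Suc.prems k' by (simp add: b'_def)
    have jg: "bcre j g = fmono b ?S0"
      using j by (simp add: g_def bcre_fmono b'_def)
    have m: "bcre 0 g \<in> W"
      unfolding g_def bcre_fmono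
    proof (rule Suc.IH)
      show "(b'(0 := b' 0 + 1)) 0 + q = k"
        using Suc.prems j by (simp add: b'_def)
      show "b'(0 := b' 0 + 1) \<in> bidx n k"
        using bidx_incr[of 0 n b' k'] b' k' by simp
    qed
    \<comment> \<open>For \<open>0 < t < p\<close> the fermionic half of \<open>gl_op t 0\<close>
      vanishes since \<open>t\<close> is already in \<open>?S0\<close>; the bosonic half turns x_0 g
      into a positive multiple of x_t g.\<close>
    have inS: "bcre t g \<in> W" if t: "t < p" for t
    proof (cases "t = 0")
      case False
      have "fcre t (fann 0 g) = 0"
        using t p False by (simp add: g_def fann_fmono op_fscale fcre_fmono)
      then have "gl_op t 0 (bcre 0 g) = fscale (of_nat (b' 0 + 1)) (bcre t g)"
        unfolding gl_op_def by (simp add: bos_ferm_commute op_zero)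
          (simp add: g_def bann_bcre_fmono op_fscale)
      moreover have "gl_op t 0 (bcre 0 g) \<in> W"
        using m t p False by (intro Winv) auto
      ultimately show ?thesis
        using Wscale[of "of_nat (b' 0 + 1)" "bcre t g"] by (metis of_nat_eq_0_iff add_is_0 one_neq_zero)
    qed (simp add: m)
    show ?case
    proof (cases "j < p")
      case True
      then show ?thesis
        using inS jg by metis
    next
      case False
      have 1: "gl_op j t (bcre t g) =
          fscale (of_nat (b' t + 1)) (bcre j g) + bcre t (fcre j (fann t g))" for t
        unfolding gl_op_def by (simp only: bos_ferm_commute g_def bann_bcre_fmono op_fscale)
      have "koszul n (fcre j g) =
          (\<Sum>t\<le>n. (if t = j then bcre j g else 0) - bcre t (fcre j (fann t g)))"
        unfolding koszul_def by (intro sum.cong refl) (auto simp: fann_fcre op_diff op_zero)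
      also have "\<dots> = bcre j g - (\<Sum>t\<le>n. bcre t (fcre j (fann t g)))"
        using j by (simp add: sum_subtractf)
      also have "(\<Sum>t\<le>n. bcre t (fcre j (fann t g))) = (\<Sum>t<p. bcre t (fcre j (fann t g)))"
        using p by (intro sum.mono_neutral_right) (auto simp: g_def fann_fmono op_zero)
      finally have 2: "koszul n (fcre j g) = bcre j g - (\<Sum>t<p. bcre t (fcre j (fann t g)))" .
      have "koszul n (fcre j g) + (\<Sum>t<p. gl_op j t (bcre t g)) =
          bcre j g + (\<Sum>t<p. fscale (of_nat (b' t + 1)) (bcre j g))"
        unfolding 1 2 sum.distrib by simp
      also have "\<dots> = fscale (of_nat (1 + (\<Sum>t<p. b' t + 1))) (bcre j g)"
        unfolding fock.scale_sum_left[symmetric] by (simp add: fock.scale_left_distrib)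
      finally have eq: "koszul n (fcre j g) + (\<Sum>t<p. gl_op j t (bcre t g)) =
          fscale (of_nat (1 + (\<Sum>t<p. b' t + 1))) (bcre j g)" .
      have "koszul n (fcre j g) + (\<Sum>t<p. gl_op j t (bcre t g)) \<in> W"
        using j p False inS
        by (intro fock.subspace_add[OF Wsub] fock.subspace_sum[OF Wsub] Wkos Winv) auto
      then have "bcre j g \<in> W"
        unfolding eq by (rule Wscale) (metis add_is_0 of_nat_eq_0_iff one_neq_zero)
      then show ?thesis
        by (simp add: jg)
    qed
  qed
  have base': "fmono b ?S0 \<in> W" if "b \<in> bidx n k" for b
  proof -
    have "b 0 \<le> (\<Sum>i\<le>n. b i)"
      by (intro member_le_sum) auto
    then show ?thesis
      using base[of b "k - b 0"] that by (simp add: bidx_def)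
  qed
  \<comment> \<open>Applied to a monomial with set \<open>S\<close>, \<open>gl_op j m\<close> has a
    bosonic half that keeps \<open>S\<close>, already in \<open>W\<close>, and a fermionic half that
    replaces \<open>m\<close> by \<open>j\<close>. The former is subtracted.\<close>
  have swap: "fmono c (insert j (S - {m})) \<in> W"
    if S: "\<And>b. b \<in> bidx n k \<Longrightarrow> fmono b S \<in> W" "S \<subseteq> {..n}" "m \<in> S" "j \<notin> S" "j \<le> n"
      and c: "c \<in> bidx n k" for S c m j
  proof -
    have "bcre j (bann m (fmono c S)) \<in> W"
    proof (cases "c m = 0")
      case True
      then show ?thesis
        using fock.subspace_0[OF Wsub] by (simp add: bann_fmono_zero op_zero)
    next
      case False
      define c' where "c' = c(m := c m - 1)"
      have "c m \<le> (\<Sum>i\<le>n. c i)"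
        using S by (intro member_le_sum) auto
      then obtain k' where k': "k = Suc k'"
        using False c by (cases k) (auto simp: bidx_def)
      have m: "m \<le> n" using S by auto
      have c': "c' \<in> bidx n k'"
        using bidx_decr[of m n c k'] m False c k' by (simp add: c'_def)
      have "fmono c S = bcre m (fmono c' S)"
        using False by (simp add: bcre_fmono c'_def)
      then have "bcre j (bann m (fmono c S)) =
          fscale (of_nat (c' m + 1)) (fmono (c'(j := c' j + 1)) S)"
        by (simp only: bann_bcre_fmono op_fscale) (simp only: bcre_fmono)
      moreover have "fmono (c'(j := c' j + 1)) S \<in> W"
        using bidx_incr[of j n c' k'] S c' k' by simp
      ultimately show ?thesis
        using fock.subspace_scale[OF Wsub] by simp
    qed
    moreover have "gl_op j m (fmono c S) \<in> W"
      using S c by (intro Winv) auto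
    ultimately have "gl_op j m (fmono c S) - bcre j (bann m (fmono c S)) \<in> W"
      using fock.subspace_diff[OF Wsub] by blast
    then have "fcre j (fann m (fmono c S)) \<in> W"
      by (simp add: gl_op_def)
    then have "fscale (fsign m S * fsign j (S - {m})) (fmono c (insert j (S - {m}))) \<in> W"
      using S by (simp add: fann_fmono op_fscale fcre_fmono)
    then show ?thesis
      by (rule Wscale) (simp add: fsign_nonzero)
  qed
  \<comment> \<open>Induction on the number of elements outside \<open>?S0\<close>, for all
    exponents together, because \<open>swap\<close> assumes them all.\<close>
  have "\<forall>b\<in>bidx n k. fmono b S \<in> W" if "S \<subseteq> {..n}" "card S = p" "card (S - ?S0) = d" for S d
    using that
  proof (induction d arbitrary: S)
    case 0
    have fin: "finite S"
      using 0 by (metis finite_atMost finite_subset)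
    then have "S \<subseteq> ?S0"
      using 0 by auto
    then have "S = ?S0"
      using 0 by (intro card_subset_eq) auto
    then show ?case
      using base' by simp
  next
    case (Suc d)
    have fin: "finite S"
      using Suc by (metis finite_atMost finite_subset)
    obtain j where j: "j \<in> S" "j \<notin> ?S0"
      using Suc.prems(3) by (metis Diff_iff card_eq_SucD insertI1)
    have "\<not> ?S0 \<subseteq> S"
      using card_subset_eq[OF fin, of ?S0] Suc.prems j by auto
    then obtain m where m: "m \<in> ?S0" "m \<notin> S"
      by auto
    let ?S' = "insert m (S - {j})"
    have "?S' - ?S0 = (S - ?S0) - {j}"
      using m by auto
    then have "card (?S' - ?S0) = d"
      using Suc.prems j fin by simp
    moreover have "card ?S' = p"
      using Suc.prems j m fin p card_Suc_Diff1[OF fin j(1)] by simp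
    moreover have "?S' \<subseteq> {..n}"
      using Suc.prems m p by auto
    ultimately have IH: "\<forall>b\<in>bidx n k. fmono b ?S' \<in> W"
      using Suc.IH by blast
    have S: "S = insert j (?S' - {m})"
      using j m by auto
    have "fmono c (insert j (?S' - {m})) \<in> W" if "c \<in> bidx n k" for c
      using IH \<open>?S' \<subseteq> {..n}\<close> m j Suc.prems that by - (rule swap[of ?S'], auto)
    then show ?case
      using S by simp
  qed
  then show ?thesis
    using bS by (auto simp: W_def)
qed

section \<open>Comparison with an irreducible representation\<close>

lemma koszul_fock_rho: "koszul n (fock_rho n X f) = fock_rho n X (koszul n f)"
  by (simp add: fock_rho_def koszul_sum koszul_fscale koszul_gl_op)

text \<open>At an index of height eigenvalue \<open>c\<close> the \<open>j\<close>-th factor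
  multiplies by \<open>j\<close>, so the projection can be read coefficientwise without splitting
  \<open>f\<close> into eigenvectors.\<close>

lemma fock_top_proj_apply:
  assumes "\<And>g. fock_rho n (height_mat n) g b S = c * g b S"
  shows "fock.top_proj n c m f b S = fact m * f b S"
  by (induction m) (simp_all add: assms fscale_apply[of _ _ b S] algebra_simps)

definition hook_hw_vec :: "nat \<Rightarrow> nat \<Rightarrow> nat \<Rightarrow> fock" where
  "hook_hw_vec n k p = koszul n (fmono (\<lambda>i. if i = 0 then k else 0) {..<p})"

lemma fock_rho_cartan_fmono:
  assumes "H \<in> cartan n"
  shows "fock_rho n H (fmono b S) =
    fscale (\<Sum>i\<le>n. of_nat (b i + of_bool (i \<in> S)) * H i i) (fmono b S)"
  by (intro ext) (auto simp: fock_rho_cartan[OF assms] fscale_apply fmono_def)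

lemma hook_hw_vec_weight:
  assumes "H \<in> cartan n"
  shows "fock_rho n H (hook_hw_vec n k p) =
    fscale (\<Sum>i\<le>n. of_int (hw_coeffs k p i) * H i i) (hook_hw_vec n k p)"
proof -
  have "of_nat ((if i = 0 then k else 0) + of_bool (i \<in> {..<p})) =
      (of_int (hw_coeffs k p i) :: complex)" for i
    by (simp add: hw_coeffs_def)
  then show ?thesis
    unfolding hook_hw_vec_def koszul_fock_rho[symmetric] fock_rho_cartan_fmono[OF assms] koszul_fscale
    by simp
qed

text \<open>Already the monomial is killed: x_j does not occur since \<open>j > 0\<close>, and after
  contracting \<open>j < p\<close> the index \<open>i < j\<close> is still in the set.\<close>

lemma hook_hw_vec_raise:
  assumes "i < j" "j \<le> n"
  shows "fock_rho n (elem_mat i j) (hook_hw_vec n k p) = 0"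
proof -
  have "gl_op i j (fmono (\<lambda>i. if i = 0 then k else 0) {..<p}) = 0"
    using assms by (simp add: gl_op_def bann_fmono_zero op_zero fann_fmono op_fscale fcre_fmono)
  then show ?thesis
    using assms by (simp add: hook_hw_vec_def fock_rho_elem_mat koszul_zero flip: koszul_gl_op)
qed

lemma koszul_hook_hw_vec: "koszul n (hook_hw_vec n k p) = 0"
  by (simp add: hook_hw_vec_def koszul_koszul)

lemma fmono_fock_part:
  "b \<in> bidx n q \<Longrightarrow> S \<subseteq> {..n} \<Longrightarrow> fmono b S \<in> fock_part n q (card S)"
  by (auto simp: fock_part_def fmono_def)

lemma hook_hw_vec_fock_part:
  assumes "1 \<le> p" "p \<le> n"
  shows "hook_hw_vec n k p \<in> fock_part n (Suc k) (p - 1)"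
proof -
  have "(\<lambda>i. if i = 0 then k else 0) \<in> bidx n k"
    by (auto simp: bidx_def)
  then have "fmono (\<lambda>i. if i = 0 then k else 0) {..<p} \<in> fock_part n k (Suc (p - 1))"
    using fmono_fock_part[where S = "{..<p}"] assms by (force simp: subset_iff)
  then show ?thesis
    unfolding hook_hw_vec_def by (rule koszul_fock_part)
qed

text \<open>Since \<open>m\<close> lies in \<open>S'\<close> but not in \<open>T\<close>, only the
  summand that contracts \<open>m\<close> can reach \<open>T\<close>. Such coefficients later serve
  as dual functionals.\<close>

lemma koszul_fmono_coeff:
  assumes m: "m \<in> S'" "m \<le> n" "m \<notin> T"
  shows "koszul n (fmono b S') (b'(m := b' m + 1)) T =
    (if b' = b \<and> S' = insert m T then fsign m T else 0)"
proof -
  have "fmono b S' c (insert i T) = 0" if "i \<noteq> m" for i c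
    using that m by (auto simp: fmono_def)
  then have "koszul n (fmono b S') (b'(m := b' m + 1)) T =
      (\<Sum>i\<le>n. if i = m then fsign m T * fmono b S' b' (insert m T) else 0)"
    unfolding koszul_apply using m by (intro sum.cong refl) auto
  then show ?thesis
    using m by (auto simp: fmono_def)
qed

lemma hook_hw_vec_nonzero:
  assumes "1 \<le> p"
  shows "hook_hw_vec n k p \<noteq> 0"
proof -
  let ?b = "\<lambda>i::nat. if i = 0 then k else 0"
  have "insert 0 ({..<p} - {0}) = {..<p}"
    using assms by auto
  then have "hook_hw_vec n k p (?b(0 := ?b 0 + 1)) ({..<p} - {0}) = fsign 0 ({..<p} - {0})"
    unfolding hook_hw_vec_def using assms by (subst koszul_fmono_coeff) auto
  then show ?thesis
    using fsign_nonzero by (metis zero_fun_apply)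
qed

section \<open>The direct sum with an abstract representation and the graph in it\<close>

definition prod_scale :: "(complex \<Rightarrow> 'v \<Rightarrow> 'v) \<Rightarrow> complex \<Rightarrow> 'v::ab_group_add \<times> fock \<Rightarrow> 'v \<times> fock" where
  "prod_scale scale c z = (scale c (fst z), fscale c (snd z))"

definition prod_rho :: "nat \<Rightarrow> (cmat \<Rightarrow> 'v \<Rightarrow> 'v) \<Rightarrow> cmat \<Rightarrow> 'v::ab_group_add \<times> fock \<Rightarrow> 'v \<times> fock" where
  "prod_rho n \<rho> X z = (\<rho> X (fst z), fock_rho n X (snd z))"

lemma prod_components:
  "fst (prod_scale scale c z) = scale c (fst z)" "snd (prod_scale scale c z) = fscale c (snd z)"
  "fst (prod_rho n \<rho> X z) = \<rho> X (fst z)" "snd (prod_rho n \<rho> X z) = fock_rho n X (snd z)"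
  by (simp_all add: prod_scale_def prod_rho_def)

context sl_rep
begin

lemma prod_sl_rep: "sl_rep (prod_scale scale) n (prod_rho n \<rho>)"
  by unfold_locales
    (simp_all add: prod_scale_def prod_rho_def prod_eq_iff scale_right_distrib scale_left_distrib
      fock.scale_right_distrib fock.scale_left_distrib rho_add rho_scale rho_plus rho_times
      rho_bracket fock.rho_add fock.rho_scale fock.rho_plus fock.rho_times fock.rho_bracket)

interpretation P: sl_rep "prod_scale scale" n "prod_rho n \<rho>"
  by (rule prod_sl_rep)

lemma fst_prod_top_proj: "fst (P.top_proj c m z) = top_proj c m (fst z)"
  by (induction m) (simp_all add: prod_components)

lemma snd_prod_top_proj: "snd (P.top_proj c m z) = fock.top_proj n c m (snd z)"
  by (induction m) (simp_all add: prod_components)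

text \<open>The submodule of the direct sum generated by the pair of highest weight vectors is the
  graph of an isomorphism: its intersection with the first summand is a proper submodule of an
  irreducible module, and its intersection with the second one is orthogonal to the highest weight
  vector and hence, by contravariance of the inner product, to everything.\<close>

lemma hook_embedding:
  assumes irr: "is_irreducible n scale \<rho>"
    and hw: "has_highest_weight n scale \<rho> (hw_coeffs k p)" and p: "1 \<le> p" "p \<le> n"
  obtains \<phi> :: "'v \<Rightarrow> fock" where
    "\<And>x y. \<phi> (x + y) = \<phi> x + \<phi> y" "\<And>c x. \<phi> (scale c x) = fscale c (\<phi> x)"
    "\<And>X x. X \<in> sl n \<Longrightarrow> \<phi> (\<rho> X x) = fock_rho n X (\<phi> x)" "\<And>x. \<phi> x = 0 \<Longrightarrow> x = 0"
    "\<And>x. \<phi> x \<in> fock_part n (Suc k) (p - 1)" "\<And>x. koszul n (\<phi> x) = 0"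
    "\<And>b S. b \<in> bidx n k \<Longrightarrow> S \<subseteq> {..n} \<Longrightarrow> card S = p \<Longrightarrow> koszul n (fmono b S) \<in> range \<phi>"
proof -
  obtain v where v: "v \<noteq> 0" "v \<in> weight_space n scale \<rho> (hw_coeffs k p)"
      "\<And>i j. i < j \<Longrightarrow> j \<le> n \<Longrightarrow> \<rho> (elem_mat i j) v = 0"
    using hw by (auto simp: has_highest_weight_def)
  define w where "w = hook_hw_vec n k p"
  define N where "N = P.cyclic (v, w)"
  \<comment> \<open>The common height eigenvalue of \<open>v\<close> and \<open>w\<close>, which
    have the same weight.\<close>
  define c where "c = (\<Sum>i\<le>n. of_int (hw_coeffs k p i) * height_mat n i i)"
  have subN: "P.subspace N"
    by (simp add: N_def P.cyclic_def)
  have vw: "(v, w) \<in> N"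
    by (simp add: N_def P.cyclic_self)
  have N0: "(0, 0) \<in> N"
    using P.subspace_0[OF subN] by (simp add: zero_prod_def)
  have Nadd: "(x + x', y + y') \<in> N" if "(x, y) \<in> N" "(x', y') \<in> N" for x y x' y'
    using P.subspace_add[OF subN that] by simp
  have Nscale: "(scale d x, fscale d y) \<in> N" if "(x, y) \<in> N" for d x y
    using P.subspace_scale[OF subN that, of d] by (simp add: prod_scale_def)
  have Ndiff: "(x - x', y - y') \<in> N" if "(x, y) \<in> N" "(x', y') \<in> N" for x y x' y'
    using P.subspace_diff[OF subN that] by simp
  have Nrho: "(\<rho> X x, fock_rho n X y) \<in> N" if "(x, y) \<in> N" "X \<in> sl n" for X x y
  proof -
    have "prod_rho n \<rho> X (x, y) \<in> N"
      unfolding N_def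
    proof (rule P.cyclic_invariant)
      show "(v, w) \<in> weight_space n (prod_scale scale) (prod_rho n \<rho>) (hw_coeffs k p)"
        using v(2) by (auto simp: weight_space_def prod_scale_def prod_rho_def w_def hook_hw_vec_weight)
      show "prod_rho n \<rho> (elem_mat i j) (v, w) = 0" if "i < j" "j \<le> n" for i j
        using v(3)[OF that] hook_hw_vec_raise[OF that]
        by (simp add: prod_rho_def w_def zero_prod_def)
    qed (use that in \<open>auto simp: N_def\<close>)
    then show ?thesis
      by (simp add: prod_rho_def)
  qed
  have hv: "\<rho> (height_mat n) v = scale c v"
    unfolding c_def by (rule weight_space_cartan[OF v(2) height_mat_in_cartan])
  have hwt: "fock_rho n (height_mat n) w = fscale c w"
    unfolding c_def w_def by (rule hook_hw_vec_weight[OF height_mat_in_cartan])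
  have hP: "prod_rho n \<rho> (height_mat n) (v, w) = prod_scale scale c (v, w)"
    by (simp add: prod_rho_def prod_scale_def hv hwt)
  \<comment> \<open>The same scalar \<open>d\<close> serves both components, since the projection of
    a pair is a multiple of \<open>(v, w)\<close>.\<close>
  have top: "\<exists>m d. top_proj c m x = scale d v \<and> fock.top_proj n c m y = fscale d w"
    if xy: "(x, y) \<in> N" for x y
  proof -
    obtain m d where "P.top_proj c m (x, y) = prod_scale scale d (v, w)"
      using P.top_proj_cyclic[OF hP] xy unfolding N_def by blast
    then have "top_proj c m x = scale d v \<and> fock.top_proj n c m y = fscale d w"
      using fst_prod_top_proj[of c m "(x, y)"] snd_prod_top_proj[of c m "(x, y)"]
      by (simp add: prod_components)
    then show ?thesis
      by blast
  qed
  have left: "x = 0" if "(x, 0) \<in> N" for x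
  proof -
    let ?K = "{x. (x, 0) \<in> N}"
    have "subspace ?K"
      unfolding subspace_def using N0 Nadd[where y = 0 and y' = 0] Nscale[where y = 0] by auto
    moreover have "\<forall>X\<in>sl n. \<forall>x\<in>?K. \<rho> X x \<in> ?K"
      using Nrho[where y = 0] by (auto simp: fock.rho_zero)
    \<comment> \<open>If \<open>(v, 0)\<close> were in \<open>N\<close>, the first component would
      give \<open>d = fact m\<close> and the second \<open>d = 0\<close>.\<close>
    moreover have "v \<notin> ?K"
    proof
      assume "v \<in> ?K"
      then obtain m d where "top_proj c m v = scale d v" "fock.top_proj n c m 0 = fscale d w"
        using top by blast
      then have "scale (fact m) v = scale d v" "fscale d w = 0"
        by (simp_all add: top_proj_top[OF hv] fock.top_proj_zero)
      moreover have "w \<noteq> 0"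
        unfolding w_def by (rule hook_hw_vec_nonzero[OF p(1)])
      ultimately show False
        using v(1) by simp
    qed
    ultimately have "?K = {0}"
      using irr unfolding is_irreducible_def by blast
    then show ?thesis
      using that by blast
  qed
  have orth_w: "fock_ip n (Suc k) w y = 0" if y: "(0, y) \<in> N" for y
  proof -
    obtain m d where "top_proj c m 0 = scale d v" and fd: "fock.top_proj n c m y = fscale d w"
      using top[OF y] by blast
    then have "d = 0"
      using v(1) by (simp add: top_proj_zero)
    \<comment> \<open>Where \<open>w\<close> is nonzero, the index has height eigenvalue
      \<open>c\<close>, so the projection multiplies \<open>y b S\<close> by \<open>fact m\<close>;
      as \<open>d = 0\<close>, this product is 0.\<close>
    have "w b S * cnj (y b S) = 0" for b S
    proof (cases "w b S = 0")
      case False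
      have "fock_rho n (height_mat n) w b S = c * w b S"
        by (simp add: hwt fscale_apply)
      then have "(\<Sum>i\<le>n. of_nat (b i + of_bool (i \<in> S)) * height_mat n i i) = c"
        using False by (simp add: fock_rho_cartan[OF height_mat_in_cartan])
      then have "fock_rho n (height_mat n) g b S = c * g b S" for g
        by (simp add: fock_rho_cartan[OF height_mat_in_cartan])
      then have "fock.top_proj n c m y b S = fact m * y b S"
        by (rule fock_top_proj_apply)
      then show ?thesis
        using fd \<open>d = 0\<close> by simp
    qed simp
    then show ?thesis
      by (simp only: fock_ip_def mult.assoc mult_zero_right sum.neutral_const)
  qed
  have words: "snd z \<in> fock_part n (Suc k) (p - 1) \<and> koszul n (snd z) = 0 \<and>
      (\<forall>y. (0, y) \<in> N \<longrightarrow> fock_ip n (Suc k) (snd z) y = 0)"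
    if "P.lowering_word (v, w) l z" for l z
    using that
  proof (induction rule: P.lowering_word.induct)
    case base
    then show ?case
      using orth_w hook_hw_vec_fock_part[OF p] by (simp add: w_def koszul_hook_hw_vec)
  next
    case (step l z j i)
    \<comment> \<open>Adjointness moves the operator to \<open>y\<close> as the matrix unit
      \<open>(j, i)\<close>, and the \<open>y\<close> with \<open>(0, y)\<close> in \<open>N\<close>
      are stable under it.\<close>
    have "fock_ip n (Suc k) (fock_rho n (elem_mat i j) (snd z)) y = 0" if "(0, y) \<in> N" for y
    proof -
      have "(0, gl_op j i y) \<in> N"
        using Nrho[OF that, of "elem_mat j i"] step.hyps
        by (simp add: elem_mat_in_sl fock_rho_elem_mat rho_zero)
      then show ?thesis
        using step by (simp add: fock_rho_elem_mat fock_ip_gl_op)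
    qed
    moreover have "elem_mat i j \<in> sl n"
      using step.hyps by (intro elem_mat_in_sl) auto
    then have "koszul n (fock_rho n (elem_mat i j) (snd z)) = 0"
      using step.IH fock.rho_zero by (metis koszul_fock_rho)
    moreover have "fock_rho n (elem_mat i j) (snd z) \<in> fock_part n (Suc k) (p - 1)"
      using step.IH fock_part_rho by blast
    ultimately show ?case
      unfolding prod_components by blast
  qed
  have all: "y \<in> fock_part n (Suc k) (p - 1) \<and> koszul n y = 0 \<and>
      (\<forall>y'. (0, y') \<in> N \<longrightarrow> fock_ip n (Suc k) y y' = 0)" if "(x, y) \<in> N" for x y
  proof -
    have "snd z \<in> fock_part n (Suc k) (p - 1) \<and> koszul n (snd z) = 0 \<and>
        (\<forall>y'. (0, y') \<in> N \<longrightarrow> fock_ip n (Suc k) (snd z) y' = 0)"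
      if "z \<in> P.span {z. \<exists>l. P.lowering_word (v, w) l z}" for z
      using that
    proof (induction rule: P.span_induct_alt)
      case base
      then show ?case
        using fock.subspace_0[OF fock_part_subspace]
        unfolding snd_zero koszul_zero fock_ip_zero_left by blast
    next
      case (step d z z')
      then obtain l where "P.lowering_word (v, w) l z" by blast
      note z = words[OF this] step.IH
      have "fscale d (snd z) + snd z' \<in> fock_part n (Suc k) (p - 1)"
        using z by (intro fock.subspace_add[OF fock_part_subspace]
            fock.subspace_scale[OF fock_part_subspace]) blast+
      moreover have "koszul n (fscale d (snd z) + snd z') = 0"
        using z by (simp only: koszul_add koszul_fscale fock.scale_zero_right add_0)
      moreover have "\<forall>y. (0, y) \<in> N \<longrightarrow> fock_ip n (Suc k) (fscale d (snd z) + snd z') y = 0"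
        using z by (auto simp: fock_ip_add_left fock_ip_fscale_left)
      ultimately show ?case
        unfolding snd_add prod_components by blast
    qed
    then show ?thesis
      using that unfolding N_def P.cyclic_def by fastforce
  qed
  \<comment> \<open>Such a \<open>y\<close> is itself a second component of \<open>N\<close>, hence
    orthogonal to itself.\<close>
  have right: "y = 0" if "(0, y) \<in> N" for y
    using all[OF that] that fock_ip_self by blast
  have total: "\<exists>y. (x, y) \<in> N" for x
  proof -
    let ?K = "{x. \<exists>y. (x, y) \<in> N}"
    have "subspace ?K"
      unfolding subspace_def using N0 Nadd Nscale by blast
    moreover have "\<forall>X\<in>sl n. \<forall>x\<in>?K. \<rho> X x \<in> ?K"
      using Nrho by blast
    moreover have "?K \<noteq> {0}"
      using vw v(1) by blast
    ultimately have "?K = UNIV"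
      using irr unfolding is_irreducible_def by blast
    then show ?thesis by blast
  qed
  have unique: "y = y'" if "(x, y) \<in> N" "(x, y') \<in> N" for x y y'
    using right[of "y - y'"] Ndiff[OF that] by simp
  define \<phi> where "\<phi> x = (SOME y. (x, y) \<in> N)" for x
  have \<phi>N: "(x, \<phi> x) \<in> N" for x
    unfolding \<phi>_def by (rule someI_ex[OF total])
  have \<phi>I: "\<phi> x = y" if "(x, y) \<in> N" for x y
    using unique[OF \<phi>N that] .
  show thesis
  proof
    show "\<phi> (x + y) = \<phi> x + \<phi> y" for x y
      by (intro \<phi>I Nadd \<phi>N)
    show "\<phi> (scale d x) = fscale d (\<phi> x)" for d x
      by (intro \<phi>I Nscale \<phi>N)
    show hom: "\<phi> (\<rho> X x) = fock_rho n X (\<phi> x)" if "X \<in> sl n" for X x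
      by (intro \<phi>I Nrho \<phi>N that)
    show "x = 0" if "\<phi> x = 0" for x
      using left[of x] \<phi>N[of x] that by simp
    show "\<phi> x \<in> fock_part n (Suc k) (p - 1)" "koszul n (\<phi> x) = 0" for x
      using all[OF \<phi>N] by blast+
    \<comment> \<open>The range is the projection of \<open>N\<close> to the Fock space, so it is a
      submodule containing \<open>w\<close>.\<close>
    have rng: "y \<in> range \<phi> \<longleftrightarrow> (\<exists>x. (x, y) \<in> N)" for y
      using \<phi>I \<phi>N by blast
    fix b S assume bS: "b \<in> bidx n k" "S \<subseteq> {..n}" "card S = p"
    show "koszul n (fmono b S) \<in> range \<phi>"
    proof (rule koszul_fmono_generated[OF _ _ _ p bS])
      show "fock.subspace (range \<phi>)"
        unfolding fock.subspace_def
      proof (intro conjI ballI allI)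
        show "0 \<in> range \<phi>"
          using N0 rng by blast
        show "x + y \<in> range \<phi>" if "x \<in> range \<phi>" "y \<in> range \<phi>" for x y
          using that Nadd unfolding rng by meson
        show "fscale d x \<in> range \<phi>" if "x \<in> range \<phi>" for d x
          using that Nscale unfolding rng by meson
      qed
      show "gl_op i j f \<in> range \<phi>" if ij: "i \<le> n" "j \<le> n" "i \<noteq> j" "f \<in> range \<phi>" for i j f
      proof -
        obtain x where "f = \<phi> x"
          using ij(4) by blast
        then have "gl_op i j f = \<phi> (\<rho> (elem_mat i j) x)"
          using ij(1-3) by (simp add: hom elem_mat_in_sl fock_rho_elem_mat)
        then show ?thesis
          by blast
      qed
      show "koszul n (fmono (\<lambda>i. if i = 0 then k else 0) {..<p}) \<in> range \<phi>"
        using vw unfolding rng w_def hook_hw_vec_def by blast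
    qed
  qed
qed

end

section \<open>Weight multiplicities\<close>

lemma sl_repI: "is_fd_rep n scale \<rho> \<Longrightarrow> sl_rep scale n \<rho>"
  unfolding is_fd_rep_def sl_rep_def sl_rep_axioms_def
  by (auto simp: Vector_Spaces.linear_iff)

lemma (in sl_rep) weight_space_subspace: "subspace (weight_space n scale \<rho> a)"
  unfolding subspace_def weight_space_def
  by (auto simp: cartan_def rho_zero rho_add rho_scale scale_right_distrib mult.commute)

text \<open>An sl-weight fixes the coefficients only up to a common constant; equality of the totals
  \<open>q + s\<close> forces that constant to be 0.\<close>

lemma fock_weight_support:
  assumes f: "f \<in> fock_part n q s" and a: "(\<Sum>i\<le>n. a i) = q + s"
    and wt: "\<And>H. H \<in> cartan n \<Longrightarrow>
      fock_rho n H f = fscale (\<Sum>i\<le>n. of_int (int (a i)) * H i i) f"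
    and ne: "f b S \<noteq> 0" and i: "i \<le> n"
  shows "b i + of_bool (i \<in> S) = a i"
proof -
  let ?c = "\<lambda>i. int (b i + of_bool (i \<in> S)) - int (a i)"
  have bS: "b \<in> bidx n q" "S \<subseteq> {..n}" "card S = s"
    using f ne by (auto simp: fock_part_def)
  have const: "?c i = ?c 0" if "i \<le> n" for i
  proof (cases "i = 0")
    case False
    \<comment> \<open>This diagonal matrix compares coordinate \<open>i\<close> with coordinate
      0.\<close>
    let ?H = "\<lambda>r s. elem_mat i i r s - elem_mat 0 0 r s"
    have sum: "(\<Sum>r\<le>n. g r * ?H r r) = g i - g 0" for g :: "nat \<Rightarrow> complex"
    proof -
      have "(\<Sum>r\<le>n. g r * ?H r r) =
          (\<Sum>r\<le>n. (if r = i then g r else 0) - (if r = 0 then g r else 0))"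
        using False by (intro sum.cong refl) (auto simp: elem_mat_def)
      then show ?thesis
        using that by (simp add: sum_subtractf)
    qed
    have H: "?H \<in> cartan n"
      using sum[of "\<lambda>_. 1"] that by (auto simp: cartan_def sl_def elem_mat_def)
    have "(\<Sum>r\<le>n. of_nat (b r + of_bool (r \<in> S)) * ?H r r) * f b S =
        (\<Sum>r\<le>n. of_int (int (a r)) * ?H r r) * f b S"
      unfolding fock_rho_cartan[OF H, of f b S, symmetric] wt[OF H] by (rule fscale_apply)
    then have "(of_nat (b i + of_bool (i \<in> S)) - of_nat (b 0 + of_bool (0 \<in> S)) :: complex) =
        of_int (int (a i)) - of_int (int (a 0))"
      unfolding sum using ne by simp
    then have "of_int (?c i) = (of_int (?c 0) :: complex)"
      by (simp add: algebra_simps)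
    then show ?thesis
      by (simp only: of_int_eq_iff)
  qed simp
  have "(\<Sum>i\<le>n. ?c i) = (\<Sum>i\<le>n. ?c 0)"
    by (rule sum.cong[OF refl], rule const) simp
  then have "(\<Sum>i\<le>n. ?c i) = int (n + 1) * ?c 0"
    by (simp only: sum_constant card_atMost Suc_eq_plus1)
  moreover have "(\<Sum>i\<le>n. ?c i) = 0"
  proof -
    have "(\<Sum>i\<le>n. of_bool (i \<in> S)) = (\<Sum>i\<in>S. 1::nat)"
      using bS by (intro sum.mono_neutral_cong_right) auto
    then have "(\<Sum>i\<le>n. b i + of_bool (i \<in> S)) = q + s"
      using bS by (simp add: sum.distrib bidx_def)
    then show ?thesis
      using a unfolding sum_subtractf of_nat_sum[symmetric] by simp
  qed
  ultimately have "?c 0 = 0"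
    by (metis mult_eq_0_iff of_nat_eq_0_iff add_is_0 one_neq_zero)
  then show ?thesis
    using const[OF i] by linarith
qed

text \<open>Evaluate the differential one step up in x_m and with \<open>m\<close> removed from the
  set: every other summand reads \<open>f\<close> at a set without \<open>m\<close>, so up to sign
  only \<open>f b S\<close> is left.\<close>

lemma koszul_kernel_determined:
  assumes ker: "koszul n f = 0" and m: "m \<le> n"
    and zero: "\<And>b S. m \<notin> S \<Longrightarrow> f b S = 0"
  shows "f = 0"
proof -
  have "f b S = 0" for b S
  proof (cases "m \<in> S")
    case True
    let ?b = "b(m := b m + 1)" and ?T = "S - {m}"
    have "0 = koszul n f ?b ?T"
      by (simp add: ker)
    also have "\<dots> = (\<Sum>i\<le>n. if i = m then fsign m ?T * f b S else 0)"
      unfolding koszul_apply using True zero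
      by (intro sum.cong refl) (auto simp: insert_absorb)
    finally show ?thesis
      using m fsign_nonzero by auto
  qed (rule zero)
  then show ?thesis
    by (intro ext) simp
qed

lemma card_nonzero_Zcount: "card {i. i \<le> n \<and> a i \<noteq> 0} + Zcount n a = n + 1"
proof -
  have "{i. i \<le> n \<and> a i \<noteq> 0} \<union> {i. i \<le> n \<and> a i = 0} = {..n}"
    "{i. i \<le> n \<and> a i \<noteq> 0} \<inter> {i. i \<le> n \<and> a i = 0} = {}"
    by auto
  then show ?thesis
    using card_Un_disjoint[of "{i. i \<le> n \<and> a i \<noteq> 0}" "{i. i \<le> n \<and> a i = 0}"]
    by (simp add: Zcount_def)
qed

lemma (in sl_rep) hook_weight_mult:
  assumes irr: "is_irreducible n scale \<rho>"
    and hw: "has_highest_weight n scale \<rho> (hw_coeffs k p)" and p: "1 \<le> p" "p \<le> n"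
    and a: "(\<Sum>i\<le>n. a i) = k + p"
  shows "weight_mult n scale \<rho> (\<lambda>i. int (a i)) = (n - Zcount n a) choose (p - 1)"
proof -
  obtain \<phi> where add: "\<And>x y. \<phi> (x + y) = \<phi> x + \<phi> y"
    and scl: "\<And>c x. \<phi> (scale c x) = fscale c (\<phi> x)"
    and hom: "\<And>X x. X \<in> sl n \<Longrightarrow> \<phi> (\<rho> X x) = fock_rho n X (\<phi> x)"
    and inj: "\<And>x. \<phi> x = 0 \<Longrightarrow> x = 0"
    and part: "\<And>x. \<phi> x \<in> fock_part n (Suc k) (p - 1)" and ker: "\<And>x. koszul n (\<phi> x) = 0"
    and rng: "\<And>b S. b \<in> bidx n k \<Longrightarrow> S \<subseteq> {..n} \<Longrightarrow> card S = p \<Longrightarrow>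
      koszul n (fmono b S) \<in> range \<phi>"
    using hook_embedding[OF irr hw p] by blast
  have inj': "x = y" if "\<phi> x = \<phi> y" for x y
    using inj[of "x - y"] add[of "x - y" y] that by simp
  let ?V = "weight_space n scale \<rho> (\<lambda>i. int (a i))"
  define A where "A = {i. i \<le> n \<and> a i \<noteq> 0}"
  have finA: "finite A"
    by (simp add: A_def)
  have "A \<noteq> {}"
  proof
    assume "A = {}"
    then have "(\<Sum>i\<le>n. a i) = 0"
      by (auto simp: A_def)
    then show False
      using a p by simp
  qed
  then obtain m where m: "m \<in> A"
    by auto
  then have mn: "m \<le> n" "a m \<noteq> 0"
    by (auto simp: A_def)
  \<comment> \<open>\<open>T\<close> stands for a set \<open>S\<close> of the basis with its fixed
    element \<open>m\<close> removed.\<close>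
  define J where "J = {T. T \<subseteq> A - {m} \<and> card T = p - 1}"
  \<comment> \<open>The subtraction is exact for \<open>T\<close> inside the support. The formula
    serves \<open>insert m T\<close> in degree \<open>k\<close> and \<open>T\<close> in degree
    \<open>k + 1\<close>.\<close>
  define bT where "bT T = (\<lambda>i. if i \<le> n then a i - of_bool (i \<in> T) else 0)" for T
  have J: "finite T" "m \<notin> T" "insert m T \<subseteq> {..n}" "insert m T \<subseteq> A" "card (insert m T) = p"
    if "T \<in> J" for T
  proof -
    show fin: "finite T"
      using that finA by (auto simp: J_def intro: finite_subset)
    show mT: "m \<notin> T" and "insert m T \<subseteq> {..n}" "insert m T \<subseteq> A"
      using that m by (auto simp: J_def A_def)
    show "card (insert m T) = p"
      using that fin mT p by (simp add: J_def)
  qed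
  have bmem: "bT S \<in> bidx n k" if S: "S \<subseteq> A" "card S = p" for S
  proof -
    have "bT S i + of_bool (i \<in> S) = a i" if "i \<le> n" for i
      using S that by (auto simp: bT_def A_def)
    then have "(\<Sum>i\<le>n. bT S i + of_bool (i \<in> S)) = (\<Sum>i\<le>n. a i)"
      by (intro sum.cong refl) simp
    then have "(\<Sum>i\<le>n. bT S i) + (\<Sum>i\<le>n. of_bool (i \<in> S)) = k + p"
      by (simp only: a sum.distrib)
    moreover have "(\<Sum>i\<le>n. of_bool (i \<in> S)) = (\<Sum>i\<in>S. 1::nat)"
      using S by (intro sum.mono_neutral_cong_right) (auto simp: A_def)
    ultimately have "(\<Sum>i\<le>n. bT S i) = k"
      using S(2) by (simp only: card_eq_sum)
    then show ?thesis
      by (simp add: bidx_def) (simp add: bT_def)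
  qed
  have "\<exists>x. \<phi> x = koszul n (fmono (bT (insert m T)) (insert m T))" if "T \<in> J" for T
    using rng[OF bmem, of "insert m T" "insert m T"] J[OF that] by (metis rangeE)
  then obtain u where u: "\<And>T. T \<in> J \<Longrightarrow> \<phi> (u T) = koszul n (fmono (bT (insert m T)) (insert m T))"
    by metis
  \<comment> \<open>By \<open>koszul_fmono_coeff\<close> this coefficient is nonzero only on the
    basis vector of \<open>T\<close>; the sign normalises the value to 1.\<close>
  define \<xi> where "\<xi> T x = fsign m T * \<phi> x (bT T) T" for T x
  have "dim ?V = card J"
  proof (rule dim_eq_card_dual[where u = "\<lambda>T. u T" and \<xi> = \<xi>])
    show "finite J"
      using finA by (auto simp: J_def)
    show "subspace ?V"
      by (rule weight_space_subspace)
    show "\<xi> j (x + y) = \<xi> j x + \<xi> j y" "\<xi> j (scale c x) = c * \<xi> j x" for j x y c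
      by (simp_all add: \<xi>_def add scl fscale_apply algebra_simps)
    show "u T \<in> ?V" if T: "T \<in> J" for T
      unfolding weight_space_def
    proof (intro CollectI ballI)
      fix H assume H: "H \<in> cartan n"
      have "of_nat (bT (insert m T) i + of_bool (i \<in> insert m T)) =
          (of_int (int (a i)) :: complex)" if "i \<le> n" for i
        using J(4)[OF T] that by (auto simp: bT_def A_def of_nat_diff Suc_leI)
      then have "(\<Sum>i\<le>n. of_nat (bT (insert m T) i + of_bool (i \<in> insert m T)) * H i i) =
          (\<Sum>i\<le>n. of_int (int (a i)) * H i i)"
        by (intro sum.cong refl) simp
      moreover have "H \<in> sl n"
        using H by (simp add: cartan_def)
      ultimately have "\<phi> (\<rho> H (u T)) = \<phi> (scale (\<Sum>i\<le>n. of_int (int (a i)) * H i i) (u T))"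
        unfolding hom[OF \<open>H \<in> sl n\<close>] scl u[OF T] koszul_fock_rho[symmetric]
          fock_rho_cartan_fmono[OF H] koszul_fscale by simp
      then show "\<rho> H (u T) = scale (\<Sum>i\<le>n. of_int (int (a i)) * H i i) (u T)"
        by (rule inj')
    qed
    show "\<xi> T (u T') = (if T = T' then 1 else 0)" if T: "T \<in> J" "T' \<in> J" for T T'
    proof -
      let ?b = "bT (insert m T)"
      \<comment> \<open>As \<open>m\<close> is outside \<open>T\<close> and \<open>a m > 0\<close>,
        dropping \<open>m\<close> from the set returns one unit to the exponent.\<close>
      have b: "bT T = ?b(m := ?b m + 1)"
        using J[OF T(1)] mn by (auto simp: bT_def fun_eq_iff)
      have eq: "?b = bT (insert m T') \<and> insert m T' = insert m T \<longleftrightarrow> T = T'"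
        using J(2)[OF T(1)] J(2)[OF T(2)] by (metis insert_ident)
      show ?thesis
        unfolding \<xi>_def u[OF T(2)] b using J(2)[OF T(1)] mn
        by (simp only: koszul_fmono_coeff insertI1 not_False_eq_True eq) (simp add: fsign_sq)
    qed
    show "x = 0" if x: "x \<in> ?V" and z: "\<And>T. T \<in> J \<Longrightarrow> \<xi> T x = 0" for x
    proof (rule inj, rule koszul_kernel_determined[OF ker mn(1)], rule ccontr)
      \<comment> \<open>The weight forces a nonzero coefficient at a set without \<open>m\<close> to
        sit at \<open>(bT S, S)\<close> with \<open>S\<close> in \<open>J\<close>, where
        \<open>\<xi> S\<close> detects it.\<close>
      fix b S assume mS: "m \<notin> S" and ne: "\<phi> x b S \<noteq> 0"
      have wt: "fock_rho n H (\<phi> x) = fscale (\<Sum>i\<le>n. of_int (int (a i)) * H i i) (\<phi> x)"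
        if "H \<in> cartan n" for H
      proof -
        have "H \<in> sl n"
          using that by (simp add: cartan_def)
        then show ?thesis
          using weight_space_cartan[OF x that] hom[of H x] scl by simp
      qed
      \<comment> \<open>The totals match because \<open>k + p = Suc k + (p - 1)\<close>.\<close>
      have bi: "b i + of_bool (i \<in> S) = a i" if "i \<le> n" for i
        by (rule fock_weight_support[OF part _ wt ne that]) (use a p in simp)
      have bS: "b \<in> bidx n (Suc k)" "S \<subseteq> {..n}" "card S = p - 1"
        using part[of x] ne by (auto simp: fock_part_def)
      have "i \<in> A" if "i \<in> S" for i
      proof -
        have "i \<le> n" using that bS by auto
        then show ?thesis using bi[of i] that by (simp add: A_def)
      qed
      then have "S \<in> J"
        using mS bS by (auto simp: J_def)
      moreover have "b i = bT S i" for i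
        using bi[of i] bS(1) by (cases "i \<le> n") (auto simp: bT_def bidx_def)
      then have "b = bT S"
        by blast
      ultimately show False
        using z[of S] ne fsign_nonzero by (simp add: \<xi>_def)
    qed
  qed
  moreover have "card J = card (A - {m}) choose (p - 1)"
    unfolding J_def using finA by (intro n_subsets) simp
  moreover have "card (A - {m}) = n - Zcount n a"
    using card_nonzero_Zcount[of n a, folded A_def] m finA by (simp add: card_Diff_singleton)
  ultimately show ?thesis
    by (simp add: weight_mult_def)
qed

text \<open>If a partial sum exceeds its bound, then fewer than \<open>p - j\<close> is left for the remaining
  entries, so fewer than \<open>p\<close> entries are nonzero.\<close>

lemma hook_binomial_zero:
  fixes a :: "nat \<Rightarrow> nat"
  assumes a: "(\<Sum>i\<le>n. a i) = k + p" and p: "1 \<le> p" "p \<le> n"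
    and j: "j \<le> p" "(\<Sum>i<j. a i) > k + j"
  shows "(n - Zcount n a) choose (p - 1) = 0"
proof -
  let ?A = "{i. i \<le> n \<and> a i \<noteq> 0}" and ?B = "{i \<in> {j..n}. a i \<noteq> 0}"
  have split: "{..n} = {..<j} \<union> {j..n}"
    using j p by auto
  have "(\<Sum>i\<le>n. a i) = (\<Sum>i<j. a i) + (\<Sum>i\<in>{j..n}. a i)"
    unfolding split by (rule sum.union_disjoint) auto
  then have rest: "(\<Sum>i\<in>{j..n}. a i) + j < p"
    using a j by linarith
  have "card ?B = (\<Sum>i\<in>?B. 1)"
    by simp
  also have "\<dots> \<le> (\<Sum>i\<in>?B. a i)"
    by (intro sum_mono) auto
  also have "\<dots> \<le> (\<Sum>i\<in>{j..n}. a i)"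
    by (intro sum_mono2) auto
  finally have "card ?B + j < p"
    using rest by linarith
  moreover have "card ?A \<le> card ({..<j} \<union> ?B)"
    by (intro card_mono) auto
  then have "card ?A \<le> j + card ?B"
    using card_Un_le[of "{..<j}" ?B] by simp
  moreover have "card ?A + Zcount n a = n + 1"
    by (rule card_nonzero_Zcount)
  \<comment> \<open>This gives \<open>Zcount n a \<le> n\<close>, so the natural subtraction
    \<open>n - Zcount n a\<close> is exact and equals \<open>card ?A - 1\<close>.\<close>
  moreover have "card ?A > 0"
  proof -
    have "?A \<noteq> {}"
    proof
      assume "?A = {}"
      then have "(\<Sum>i\<le>n. a i) = 0"
        by auto
      then show False
        using a p by simp
    qed
    then show ?thesis
      by (simp add: card_gt_0_iff)
  qed
  ultimately have "n - Zcount n a < p - 1"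
    by linarith
  then show ?thesis
    by (rule binomial_eq_0)
qed

theorem theorem6p1:
  fixes n k p :: nat
    and a :: "nat \<Rightarrow> nat"
    and scale :: "complex \<Rightarrow> 'v::ab_group_add \<Rightarrow> 'v"
    and \<rho> :: "cmat \<Rightarrow> 'v \<Rightarrow> 'v"
  assumes "1 \<le> n" and "1 \<le> p" and "p \<le> n"
    and "(\<Sum>i\<le>n. a i) = k + p"
    and "is_fd_rep n scale \<rho>" and "is_irreducible n scale \<rho>"
    and "has_highest_weight n scale \<rho> (hw_coeffs k p)"
  shows "weight_mult n scale \<rho> (\<lambda>i. int (a i)) =
           (if (\<forall>j. 1 \<le> j \<and> j \<le> p \<longrightarrow> (\<Sum>i<j. a i) \<le> k + j)
            then (n - Zcount n a) choose (p - 1) else 0)"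
proof -
  have mult: "weight_mult n scale \<rho> (\<lambda>i. int (a i)) = (n - Zcount n a) choose (p - 1)"
    using assms by (intro sl_rep.hook_weight_mult sl_repI)
  show ?thesis
  proof (cases "\<forall>j. 1 \<le> j \<and> j \<le> p \<longrightarrow> (\<Sum>i<j. a i) \<le> k + j")
    case False
    then obtain j where "j \<le> p" "(\<Sum>i<j. a i) > k + j"
      by (auto simp: not_le)
    then have "(n - Zcount n a) choose (p - 1) = 0"
      by (rule hook_binomial_zero[OF assms(4,2,3)])
    then show ?thesis
      using False mult by simp
  qed (simp add: mult)
qed

end
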